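(* Let $p\in[1,\infty)$. Let $F:\mathbb{T}\to\mathbb{C}$ be absolutely continuous with $\dot F\in L^{p}(\mathbb{T})$, and let $f=P[F]$ be its Poisson integral, a harmonic mapping of $\mathbb{D}$. Then both $f_{z}$ and $\overline{f_{\overline{z}}}$ belong to the Bergman space $\mathcal{B}^{p}(\mathbb{D})$, i.e. $\int_{\mathbb{D}}|f_z|^p\,d\sigma<\infty$ and $\int_{\mathbb{D}}|f_{\overline z}|^p\,d\sigma<\infty$.
   Context: $\mathbb{D}$ is the open unit disk, $\mathbb{T}=\partial\mathbb{D}$. For $z=x+iy$, $\partial/\partial z=\frac12(\partial_x-i\partial_y)$ and $\partial/\partial\overline z=\frac12(\partial_x+i\partial_y)$. For $F\in L^1(\mathbb{T})$ the Poisson integral is $P[F](z)=\int_0^{2\pi}P(z,e^{i\theta})F(e^{i\theta})\,d\theta$ with $P(z,e^{i\theta})=\frac{1}{2\pi}\frac{1-|z|^2}{|1-ze^{-i\theta}|^2}$. $\dot F(e^{i\theta})=\frac{d}{d\theta}F(e^{i\theta})$ (defined a.e.). $L^p(\mathbb{T})$ is the space of measurable $F$ with $\|F\|_{L^p}=\big(\frac{1}{2\pi}\int_0^{2\pi}|F(e^{i\theta})|^p d\theta\big)^{1/p}<\infty$ (ess sup norm if $p=\infty$). $d\sigma=\frac1\pi\,dx\,dy$ is normalized area measure on $\mathbb{D}$; for $p\in(0,\infty)$, $\mathcal{B}^p(\mathbb{D})$ is the space of analytic functions $g$ on $\mathbb{D}$ with $\int_{\mathbb{D}}|g|^p d\sigma<\infty$,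 and $\mathcal{B}^\infty(\mathbb{D})$ consists of the bounded analytic functions on $\mathbb{D}$. *)

theory Defs
  imports "HOL-Complex_Analysis.Complex_Analysis"
begin

definition abs_continuous_on :: "real \<Rightarrow> real \<Rightarrow> (real \<Rightarrow> 'a::real_normed_vector) \<Rightarrow> bool" where
  "abs_continuous_on a b g \<longleftrightarrow>
     (\<forall>\<epsilon>>0. \<exists>\<delta>>0. \<forall>(n::nat) (u::nat \<Rightarrow> real) (v::nat \<Rightarrow> real).
        (\<forall>k<n. a \<le> u k \<and> u k \<le> v k \<and> v k \<le> b) \<and>
        (\<forall>j<n. \<forall>k<n. j \<noteq> k \<longrightarrow> v j \<le> u k \<or> v k \<le> u j) \<and>
        (\<Sum>k<n. v k - u k) < \<delta>
        \<longrightarrow> (\<Sum>k<n. norm (g (v k) - g (u k))) < \<epsilon>)"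

definition poisson_kernel :: "complex \<Rightarrow> real \<Rightarrow> real" where
  "poisson_kernel z \<theta> = (1 / (2 * pi)) * (1 - (cmod z)\<^sup>2) / (cmod (1 - z * cis (- \<theta>)))\<^sup>2"

definition poisson_integral :: "(complex \<Rightarrow> complex) \<Rightarrow> complex \<Rightarrow> complex" where
  "poisson_integral F z = integral {0..2*pi} (\<lambda>\<theta>. of_real (poisson_kernel z \<theta>) * F (cis \<theta>))"

definition dx :: "(complex \<Rightarrow> complex) \<Rightarrow> complex \<Rightarrow> complex" where
  "dx f z = vector_derivative (\<lambda>t::real. f (z + of_real t)) (at 0)"

definition dy :: "(complex \<Rightarrow> complex) \<Rightarrow> complex \<Rightarrow> complex" where
  "dy f z = vector_derivative (\<lambda>t::real. f (z + \<i> * of_real t)) (at 0)"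

definition dz :: "(complex \<Rightarrow> complex) \<Rightarrow> complex \<Rightarrow> complex" where
  "dz f z = (dx f z - \<i> * dy f z) / 2"

definition dzbar :: "(complex \<Rightarrow> complex) \<Rightarrow> complex \<Rightarrow> complex" where
  "dzbar f z = (dx f z + \<i> * dy f z) / 2"

definition Lp_circle :: "real \<Rightarrow> (real \<Rightarrow> complex) \<Rightarrow> bool" where
  "Lp_circle p g \<longleftrightarrow> g \<in> borel_measurable (lebesgue_on {0..2*pi}) \<and>
      (\<lambda>\<theta>. norm (g \<theta>) powr p) integrable_on {0..2*pi}"

text \<open>Bergman space B^p(D), p finite (normalisation of area measure is irrelevant).\<close>
definition bergman_space :: "real \<Rightarrow> (complex \<Rightarrow> complex) set" where
  "bergman_space p = {g. g holomorphic_on ball 0 1 \<and>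
      (\<lambda>z. norm (g z) powr p) integrable_on ball 0 1}"

end

theory Submission
  imports Defs
begin

text \<open>
  Write \<open>G \<theta> = F (cis \<theta>)\<close>. Splitting the Poisson kernel into \<open>1 / (1 - z cis (- \<theta>))\<close>, its conjugate
  and a constant gives \<open>f = h + cnj k\<close> with \<open>h\<close>, \<open>k\<close> holomorphic, so \<open>f\<^sub>z = h'\<close> and the conjugate
  of the other derivative is \<open>k'\<close>. Integrating by parts (\<open>G\<close> is absolutely continuous and periodic),
  \<open>h'\<close> is, up to a constant, the Cauchy transform \<open>\<integral> G' \<theta> / (cis \<theta> - z) d\<theta>\<close>, and \<open>k'\<close> is the same
  for \<open>cnj G\<close>. No boundedness of the conjugation operator is needed: Jensen's inequality for the
  weight \<open>\<bar>cis \<theta> - z\<bar> powr - \<beta>\<close>, with \<open>\<beta> < 1\<close> close to 1, bounds the \<open>p\<close>-th power of the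
  transform by a constant times \<open>\<integral> \<bar>G' \<theta>\<bar>\<^sup>p \<bar>cis \<theta> - z\<bar> powr - e d\<theta>\<close> with \<open>e < 2\<close>, and
  \<open>\<bar>cis \<theta> - z\<bar> powr - e\<close> has bounded integral over the disk, so Tonelli's theorem concludes.
\<close>

section \<open>Absolutely continuous functions\<close>

text \<open>Numbering the index set by a bijection with an initial segment of the naturals gives the
  freedom to index intervals by any finite set, such as the members of a tagged division.\<close>

lemma abs_continuous_on_finite:
  assumes "abs_continuous_on a b g" "\<epsilon> > 0"
  shows "\<exists>\<delta>>0. \<forall>(I::'i set) u v. finite I \<and> (\<forall>i\<in>I. a \<le> u i \<and> u i \<le> v i \<and> v i \<le> b) \<and>
       (\<forall>i\<in>I. \<forall>j\<in>I. i \<noteq> j \<longrightarrow> v i \<le> u j \<or> v j \<le> u i) \<and>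
       (\<Sum>i\<in>I. v i - u i) < \<delta> \<longrightarrow> (\<Sum>i\<in>I. norm (g (v i) - g (u i))) < \<epsilon>"
proof -
  obtain \<delta> where "\<delta> > 0" and \<delta>: "\<forall>(n::nat) (u::nat \<Rightarrow> real) (v::nat \<Rightarrow> real).
        (\<forall>k<n. a \<le> u k \<and> u k \<le> v k \<and> v k \<le> b) \<and>
        (\<forall>j<n. \<forall>k<n. j \<noteq> k \<longrightarrow> v j \<le> u k \<or> v k \<le> u j) \<and>
        (\<Sum>k<n. v k - u k) < \<delta>
        \<longrightarrow> (\<Sum>k<n. norm (g (v k) - g (u k))) < \<epsilon>"
    using assms unfolding abs_continuous_on_def by blast
  show ?thesis
  proof (intro exI[of _ \<delta>] conjI[OF \<open>\<delta> > 0\<close>] allI impI; elim conjE)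
    fix I :: "'i set" and u v :: "'i \<Rightarrow> real"
    assume I: "finite I" and uv: "\<forall>i\<in>I. a \<le> u i \<and> u i \<le> v i \<and> v i \<le> b"
      and disj: "\<forall>i\<in>I. \<forall>j\<in>I. i \<noteq> j \<longrightarrow> v i \<le> u j \<or> v j \<le> u i"
      and small: "(\<Sum>i\<in>I. v i - u i) < \<delta>"
    obtain h where "bij_betw h {0..<card I} I"
      using ex_bij_betw_nat_finite[OF I] by blast
    then have h: "bij_betw h {..<card I} I"
      by (simp add: lessThan_atLeast0)
    have hI: "h k \<in> I" if "k < card I" for k
      using h that by (auto simp: bij_betw_def)
    have inj: "h j \<noteq> h k" if "j < card I" "k < card I" "j \<noteq> k" for j k
      using h that by (auto simp: bij_betw_def inj_on_def)
    have "(\<Sum>k<card I. norm (g (v (h k)) - g (u (h k)))) < \<epsilon>"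
    proof (rule \<delta>[rule_format], intro conjI allI impI)
      show "(\<Sum>k<card I. v (h k) - u (h k)) < \<delta>"
        using small sum.reindex_bij_betw[OF h, of "\<lambda>i. v i - u i"] by simp
    qed (use uv disj hI inj in auto)
    then show "(\<Sum>i\<in>I. norm (g (v i) - g (u i))) < \<epsilon>"
      using sum.reindex_bij_betw[OF h, of "\<lambda>i. norm (g (v i) - g (u i))"] by simp
  qed
qed

lemma abs_continuous_on_imp_continuous_on:
  assumes "abs_continuous_on a b g"
  shows "continuous_on {a..b} g"
  unfolding continuous_on_iff
proof (intro ballI allI impI)
  fix x \<epsilon> :: real assume x: "x \<in> {a..b}" and "\<epsilon> > 0"
  obtain \<delta> where "\<delta> > 0" and \<delta>: "\<forall>(I::unit set) u v.
      finite I \<and> (\<forall>i\<in>I. a \<le> u i \<and> u i \<le> v i \<and> v i \<le> b) \<and>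
      (\<forall>i\<in>I. \<forall>j\<in>I. i \<noteq> j \<longrightarrow> v i \<le> u j \<or> v j \<le> u i) \<and>
      (\<Sum>i\<in>I. v i - u i) < \<delta> \<longrightarrow> (\<Sum>i\<in>I. norm (g (v i) - g (u i))) < \<epsilon>"
    using abs_continuous_on_finite[OF assms \<open>\<epsilon> > 0\<close>] by blast
  have "dist (g y) (g x) < \<epsilon>" if y: "y \<in> {a..b}" "dist y x < \<delta>" for y
    \<comment> \<open>A single interval suffices; \<open>min\<close> and \<open>max\<close> treat
      both orders of \<open>x\<close> and \<open>y\<close> at once.\<close>
    using \<delta>[rule_format, of "{()}" "\<lambda>_. min x y" "\<lambda>_. max x y"] x y
    by (cases "x \<le> y") (auto simp: dist_norm norm_minus_commute)
  then show "\<exists>d>0. \<forall>y\<in>{a..b}. dist y x < d \<longrightarrow> dist (g y) (g x) < \<epsilon>"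
    using \<open>\<delta> > 0\<close> by blast
qed

text \<open>An increment of the product is an increment of \<open>f\<close> times a bounded value of
  \<open>\<psi>\<close>, plus a bounded value of \<open>f\<close> times an increment of
  \<open>\<psi>\<close>, which is at most \<open>L\<close> times the length. Integration by parts
  applies this to the boundary function times the Cauchy kernel.\<close>

lemma abs_continuous_on_mult_Lipschitz:
  fixes f \<psi> :: "real \<Rightarrow> 'a::real_normed_algebra"
  assumes f: "abs_continuous_on a b f" and \<psi>: "L-lipschitz_on {a..b} \<psi>"
  shows "abs_continuous_on a b (\<lambda>t. f t * \<psi> t)"
  unfolding abs_continuous_on_def
proof (intro allI impI)
  fix \<epsilon> :: real assume "\<epsilon> > 0"
  have "bounded (f ` {a..b})" "bounded (\<psi> ` {a..b})"
    using abs_continuous_on_imp_continuous_on[OF f] lipschitz_on_continuous_on[OF \<psi>]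
    by (simp_all add: compact_imp_bounded compact_continuous_image)
  then obtain M M' where M: "M > 0" "\<And>t. t \<in> {a..b} \<Longrightarrow> norm (f t) \<le> M"
    and M': "M' > 0" "\<And>t. t \<in> {a..b} \<Longrightarrow> norm (\<psi> t) \<le> M'"
    by (auto simp: bounded_pos)
  have "L \<ge> 0" using \<psi> by (simp add: lipschitz_on_def)
  obtain \<delta> where "\<delta> > 0" and \<delta>: "\<forall>(n::nat) (u::nat \<Rightarrow> real) (v::nat \<Rightarrow> real).
        (\<forall>k<n. a \<le> u k \<and> u k \<le> v k \<and> v k \<le> b) \<and>
        (\<forall>j<n. \<forall>k<n. j \<noteq> k \<longrightarrow> v j \<le> u k \<or> v k \<le> u j) \<and>
        (\<Sum>k<n. v k - u k) < \<delta>
        \<longrightarrow> (\<Sum>k<n. norm (f (v k) - f (u k))) < \<epsilon> / (2 * M')"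
    using f[unfolded abs_continuous_on_def, rule_format, of "\<epsilon> / (2 * M')"] \<open>M' > 0\<close> \<open>\<epsilon> > 0\<close> by auto
  \<comment> \<open>Each of the two parts is to contribute less than \<open>\<epsilon> / 2\<close>.
    Taking \<open>L + 1\<close> for \<open>L\<close> avoids a zero denominator if
    \<open>L = 0\<close>.\<close>
  define \<delta>' where "\<delta>' = min \<delta> (\<epsilon> / (2 * M * (L + 1)))"
  have "\<delta>' > 0"
    using \<open>\<delta> > 0\<close> \<open>M > 0\<close> \<open>L \<ge> 0\<close> \<open>\<epsilon> > 0\<close> by (simp add: \<delta>'_def)
  moreover have "(\<Sum>k<n. norm (f (v k) * \<psi> (v k) - f (u k) * \<psi> (u k))) < \<epsilon>"
    if *: "(\<forall>k<n. a \<le> u k \<and> u k \<le> v k \<and> v k \<le> b) \<and>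
        (\<forall>j<n. \<forall>k<n. j \<noteq> k \<longrightarrow> v j \<le> u k \<or> v k \<le> u j) \<and>
        (\<Sum>k<n. v k - u k) < \<delta>'" for n :: nat and u v
  proof -
    have "norm (f (v k) * \<psi> (v k) - f (u k) * \<psi> (u k))
        \<le> M' * norm (f (v k) - f (u k)) + M * (L + 1) * (v k - u k)" if "k < n" for k
    proof -
      have uv: "u k \<in> {a..b}" "v k \<in> {a..b}" "u k \<le> v k"
        using * that by force+
      have "f (v k) * \<psi> (v k) - f (u k) * \<psi> (u k) =
          (f (v k) - f (u k)) * \<psi> (v k) + f (u k) * (\<psi> (v k) - \<psi> (u k))"
        by (simp add: algebra_simps)
      also have "norm \<dots> \<le> norm (f (v k) - f (u k)) * norm (\<psi> (v k))
          + norm (f (u k)) * norm (\<psi> (v k) - \<psi> (u k))"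
        by (intro norm_triangle_le add_mono norm_mult_ineq)
      also have "\<dots> \<le> norm (f (v k) - f (u k)) * M' + M * ((L + 1) * (v k - u k))"
      proof (intro add_mono mult_mono)
        have "norm (\<psi> (v k) - \<psi> (u k)) \<le> L * (v k - u k)"
          using lipschitz_onD[OF \<psi> uv(2,1)] uv by (simp add: dist_norm)
        then show "norm (\<psi> (v k) - \<psi> (u k)) \<le> (L + 1) * (v k - u k)"
          using uv by (simp add: algebra_simps)
      qed (use M M' uv in auto)
      finally show ?thesis by (simp add: mult_ac)
    qed
    then have "(\<Sum>k<n. norm (f (v k) * \<psi> (v k) - f (u k) * \<psi> (u k)))
        \<le> (\<Sum>k<n. M' * norm (f (v k) - f (u k)) + M * (L + 1) * (v k - u k))"
      by (intro sum_mono) simp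
    also have "\<dots> = M' * (\<Sum>k<n. norm (f (v k) - f (u k))) + M * (L + 1) * (\<Sum>k<n. v k - u k)"
      by (simp add: sum.distrib sum_distrib_left)
    also have "\<dots> < M' * (\<epsilon> / (2 * M')) + M * (L + 1) * (\<epsilon> / (2 * M * (L + 1)))"
      using * \<open>M > 0\<close> \<open>M' > 0\<close> \<open>L \<ge> 0\<close>
      by (intro add_strict_mono mult_strict_left_mono \<delta>[rule_format]) (auto simp: \<delta>'_def)
    also have "\<dots> = \<epsilon>"
    proof -
      have "M * (L + 1) \<noteq> 0" using \<open>M > 0\<close> \<open>L \<ge> 0\<close> by simp
      then have "M * (L + 1) * (\<epsilon> / (2 * M * (L + 1))) = \<epsilon> / 2"
        using nonzero_mult_div_cancel_left[of "M * (L + 1)" "\<epsilon> / 2"]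
        by (simp add: mult.assoc)
      then show ?thesis using \<open>M' > 0\<close> by simp
    qed
    finally show ?thesis .
  qed
  ultimately show "\<exists>\<delta>>0. \<forall>(n::nat) u v.
        (\<forall>k<n. a \<le> u k \<and> u k \<le> v k \<and> v k \<le> b) \<and>
        (\<forall>j<n. \<forall>k<n. j \<noteq> k \<longrightarrow> v j \<le> u k \<or> v k \<le> u j) \<and>
        (\<Sum>k<n. v k - u k) < \<delta>
        \<longrightarrow> (\<Sum>k<n. norm (f (v k) * \<psi> (v k) - f (u k) * \<psi> (u k))) < \<epsilon>"
    by blast
qed

text \<open>Each cell has the measure of its interior, and distinct members of \<open>p\<close> have
  disjoint interiors, so the sum is the measure of a disjoint union inside \<open>U\<close>. This
  bounds the total length of the intervals tagged in an exceptional null set.\<close>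

lemma sum_content_tagged_partial_division_le:
  fixes S :: "'a::euclidean_space set"
  assumes p: "p tagged_partial_division_of S" and U: "U \<in> lmeasurable"
    and sub: "\<And>x K. (x, K) \<in> p \<Longrightarrow> K \<subseteq> U"
  shows "(\<Sum>(x,K)\<in>p. measure lborel K) \<le> measure lebesgue U"
proof -
  note pD = tagged_partial_division_ofD[OF p]
  have int: "measure lborel K = measure lebesgue (interior K)" "interior K \<in> lmeasurable" 
    if xK: "(x, K) \<in> p" for x K
  proof -
    obtain c d where "K = cbox c d" using pD(4)[OF xK] by blast
    then show "measure lborel K = measure lebesgue (interior K)" "interior K \<in> lmeasurable"
      by (auto simp: interior_cbox content_eq_0 measure_lborel_box_eq measure_lborel_cbox_eq)
  qed
  have "(\<Sum>(x,K)\<in>p. measure lborel K) = (\<Sum>q\<in>p. measure lebesgue (interior (snd q)))"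
    by (intro sum.cong) (auto simp: int)
  also have "\<dots> = measure lebesgue (\<Union>q\<in>p. interior (snd q))"
  proof (rule measure_finite_Union[symmetric])
    show "disjoint_family_on (\<lambda>q. interior (snd q)) p"
      using pD(5) by (fastforce simp: disjoint_family_on_def)
    show "(\<lambda>q. interior (snd q)) ` p \<subseteq> sets lebesgue"
      using int by (auto simp: fmeasurableD)
    show "emeasure lebesgue (interior (snd q)) \<noteq> \<infinity>" if "q \<in> p" for q
      using int(2)[of "fst q" "snd q"] that by (auto simp: fmeasurable_def)
  qed (use pD(1) in auto)
  also have "\<dots> \<le> measure lebesgue U"
  proof (rule measure_mono_fmeasurable[OF _ _ U])
    show "(\<Union>q\<in>p. interior (snd q)) \<subseteq> U"
      using sub interior_subset by fastforce
    show "(\<Union>q\<in>p. interior (snd q)) \<in> sets lebesgue"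
      using int(2) pD(1) by (auto intro!: sets.finite_UN fmeasurableD)
  qed
  finally show ?thesis .
qed

text \<open>Henstock-Kurzweil argument: outside the null set \<open>N\<close> the straddle estimate applies; the gauge
  confines the intervals tagged in \<open>N\<close> to an open set of small measure, where absolute continuity
  makes the total increment small.\<close>

theorem fundamental_theorem_of_calculus_abs_continuous:
  fixes f :: "real \<Rightarrow> 'a::euclidean_space"
  assumes "a \<le> b" and ac: "abs_continuous_on a b f"
    and deriv: "AE x in lborel. x \<in> {a..b} \<longrightarrow> (f has_vector_derivative f' x) (at x within {a..b})"
  shows "(f' has_integral (f b - f a)) {a..b}"
proof -
  obtain N where N: "N \<in> null_sets lborel"
    and derN: "\<And>x. \<lbrakk>x \<in> {a..b}; x \<notin> N\<rbrakk> \<Longrightarrow> (f has_vector_derivative f' x) (at x within {a..b})"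
    using deriv by (auto elim!: AE_E simp: null_sets_def) blast
  have negl: "negligible N" 
    using N by (simp add: negligible_iff_null_sets null_sets_completionI)
  \<comment> \<open>On \<open>N\<close> the values of \<open>f'\<close> may be arbitrary. With the
    value 0 there, a tag in \<open>N\<close> adds nothing to the Riemann sum, and the change on a
    null set is undone at the end.\<close>
  define g where "g = (\<lambda>x. if x \<in> N then 0 else f' x)"
  have "(g has_integral (f b - f a)) (cbox a b)"
    unfolding has_integral
  proof (intro allI impI)
    fix e :: real assume "e > 0"
    obtain \<delta> where "\<delta> > 0" and \<delta>: "\<forall>(I::(real \<times> real set) set) u v.
      finite I \<and> (\<forall>i\<in>I. a \<le> u i \<and> u i \<le> v i \<and> v i \<le> b) \<and>
      (\<forall>i\<in>I. \<forall>j\<in>I. i \<noteq> j \<longrightarrow> v i \<le> u j \<or> v j \<le> u i) \<and>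
      (\<Sum>i\<in>I. v i - u i) < \<delta> \<longrightarrow> (\<Sum>i\<in>I. norm (f (v i) - f (u i))) < e / 2"
    using abs_continuous_on_finite[OF ac half_gt_zero[OF \<open>e > 0\<close>]] by blast
    \<comment> \<open>Outer regularity gives an open cover of \<open>N\<close> that exceeds it by
      measure less than \<open>\<delta>\<close>; adding the null set \<open>N\<close> itself leaves
      the measure unchanged.\<close>
    obtain U where U: "open U" "N \<subseteq> U" "U \<in> lmeasurable" "measure lebesgue U < \<delta>"
    proof -
      obtain T where T: "open T" "N \<subseteq> T" "(T - N) \<in> lmeasurable" "emeasure lebesgue (T - N) < ennreal \<delta>"
        using sets_lebesgue_outer_open[OF negligible_imp_sets[OF negl] \<open>\<delta> > 0\<close>] by blast
      have "T = (T - N) \<union> N" using T by blast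
      then have "T \<in> lmeasurable" "measure lebesgue T = measure lebesgue (T - N)"
        using T(3) negl by (metis fmeasurable.Un negligible_imp_measurable)
          (metis T(3) negl \<open>T = (T - N) \<union> N\<close> measure_Un_null_set fmeasurableD negligible_iff_null_sets)
      moreover have "measure lebesgue (T - N) < \<delta>"
        using T(3,4) \<open>\<delta> > 0\<close> by (simp add: emeasure_eq_measure2 ennreal_less_iff)
      ultimately show ?thesis using that T by auto
    qed
    \<comment> \<open>Chosen so that \<open>e' * (b - a) \<le> e / 2\<close>; the summand 2 keeps
      the denominator positive if \<open>a = b\<close>.\<close>
    define e' where "e' = e / (2 * (b - a) + 2)"
    have "e' > 0" using \<open>a \<le> b\<close> \<open>e > 0\<close> by (simp add: e'_def)
    have "\<exists>d>0. (x \<in> N \<longrightarrow> ball x d \<subseteq> U) \<and> (x \<in> {a..b} - N \<longrightarrow>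
         (\<forall>y\<in>{a..b}. norm (y-x) < d \<longrightarrow> norm (f y - f x - (y-x) *\<^sub>R f' x) \<le> e' * norm (y-x)))" for x
    proof (cases "x \<in> N")
      case True
      then obtain d where "d > 0" "ball x d \<subseteq> U" using U openE by blast
      then show ?thesis using True by auto
    next
      case False
      then show ?thesis
        using derN[of x] \<open>e' > 0\<close>
        unfolding has_vector_derivative_def has_derivative_within_alt
        by (cases "x \<in> {a..b}") (auto intro: exI[of _ 1])
    qed
    then obtain d where d: "\<And>x. 0 < d x" "\<And>x. x \<in> N \<Longrightarrow> ball x (d x) \<subseteq> U"
                 "\<And>x y. \<lbrakk>x \<in> {a..b}; x \<notin> N; y \<in> {a..b}; norm (y-x) < d x\<rbrakk>
                        \<Longrightarrow> norm (f y - f x - (y-x) *\<^sub>R f' x) \<le> e' * norm (y-x)"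
      by (metis DiffI)
    show "\<exists>\<gamma>. gauge \<gamma> \<and> (\<forall>p. p tagged_division_of (cbox a b) \<and> \<gamma> fine p \<longrightarrow>
      norm ((\<Sum>(x, k)\<in>p. measure lborel k *\<^sub>R g x) - (f b - f a)) < e)"
    proof (intro exI conjI allI impI; (elim conjE)?)
      show "gauge (\<lambda>x. ball x (d x))"
        using d(1) gauge_ball_dependent by blast
      fix p
      assume ptag: "p tagged_division_of cbox a b" and finep: "(\<lambda>x. ball x (d x)) fine p"
      note pD = tagged_division_ofD[OF ptag]
      have Kint: "{Inf K..Sup K} = K" and K: "Inf K \<le> x \<and> x \<le> Sup K \<and> a \<le> Inf K \<and> Sup K \<le> b 
          \<and> measure lborel K = Sup K - Inf K \<and> K \<subseteq> ball x (d x)"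
        if xK: "(x, K) \<in> p" for x K
      proof -
        obtain u v where uv: "K = cbox u v" using pD(4)[OF xK] by blast
        have "x \<in> K" "K \<subseteq> cbox a b" "K \<subseteq> ball x (d x)"
          using pD(2,3)[OF xK] finep xK by (auto simp: fine_def)
        then show "{Inf K..Sup K} = K" "Inf K \<le> x \<and> x \<le> Sup K \<and> a \<le> Inf K \<and> Sup K \<le> b 
          \<and> measure lborel K = Sup K - Inf K \<and> K \<subseteq> ball x (d x)"
          using uv by auto
      qed
      have ba: "b - a = (\<Sum>(x,K)\<in>p. Sup K - Inf K)" "f b - f a = (\<Sum>(x,K)\<in>p. f(Sup K) - f(Inf K))"
        using additive_tagged_division_1[where f= "\<lambda>x. x"] additive_tagged_division_1[where f= f]
            \<open>a \<le> b\<close> ptag by auto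
      \<comment> \<open>Degenerate intervals stay out of \<open>B\<close>: such a point may lie in
        the interior of another cell, and then the ordering required by absolute continuity fails.
        Outside \<open>B\<close> they are harmless, since both their content and their increment
        vanish.\<close>
      define B where "B = {(x,K)\<in>p. x \<in> N \<and> Inf K < Sup K}"
      have fin: "finite p" "B \<subseteq> p" "finite B"
        using pD(1) by (auto simp: B_def intro: finite_subset)
      have good: "norm (measure lborel K *\<^sub>R g x - (f (Sup K) - f (Inf K))) \<le> e' * (Sup K - Inf K)"
        if xK: "(x, K) \<in> p - B" for x K
      proof (cases "x \<in> N")
        case True
        then have "Inf K = Sup K" using xK K[of x K] by (auto simp: B_def)
        then show ?thesis using True by (simp add: g_def)
      next
        case False
        define u v where "u = Inf K" and "v = Sup K"
        have uv: "K = {u..v}" "u \<le> x" "x \<le> v" "a \<le> u" "v \<le> b" "measure lborel K = v - u" "K \<subseteq> ball x (d x)"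
          using K[of x K] Kint[of x K] xK by (auto simp: u_def v_def)
        have "u \<in> K" "v \<in> K" using uv by auto
        then have "u \<in> ball x (d x)" "v \<in> ball x (d x)" using uv(7) by blast+
        then have *: "norm (u - x) < d x" "norm (v - x) < d x" by (auto simp: dist_real_def)
        \<comment> \<open>Straddle estimate: the increment over the cell is split at its tag
          \<open>x\<close>, and \<open>\<bar>u - x\<bar> + \<bar>v - x\<bar> = v - u\<close> because
          \<open>x\<close> lies between the endpoints.\<close>
        have "norm ((v - u) *\<^sub>R f' x - (f v - f u)) =
            norm ((f u - f x - (u - x) *\<^sub>R f' x) - (f v - f x - (v - x) *\<^sub>R f' x))"
          by (auto simp: algebra_simps)
        also have "\<dots> \<le> norm (f u - f x - (u - x) *\<^sub>R f' x) + norm (f v - f x - (v - x) *\<^sub>R f' x)"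
          by (rule norm_triangle_ineq4)
        also have "\<dots> \<le> e' * norm (u - x) + e' * norm (v - x)"
          using uv False * by (intro add_mono d) auto
        also have "\<dots> = e' * (v - u)"
          using uv by (auto simp: algebra_simps)
        finally show ?thesis
          using uv(6) False by (simp add: g_def flip: u_def v_def)
      qed
      have "(\<Sum>(x,K)\<in>B. norm (f (Sup K) - f (Inf K))) < e / 2"
      proof -
        have "(\<Sum>q\<in>B. norm (f (Sup (snd q)) - f (Inf (snd q)))) < e / 2"
        proof (rule \<delta>[rule_format], intro conjI ballI impI \<open>finite B\<close>)
          show "a \<le> Inf (snd q)" "Inf (snd q) \<le> Sup (snd q)" "Sup (snd q) \<le> b" if "q \<in> B" for q
            using K[of "fst q" "snd q"] that by (auto simp: B_def)
          show "Sup (snd q) \<le> Inf (snd r) \<or> Sup (snd r) \<le> Inf (snd q)"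
            if "q \<in> B" "r \<in> B" "q \<noteq> r" for q r
          proof -
            define u v u' v' where "u = Inf (snd q)" "v = Sup (snd q)" "u' = Inf (snd r)" "v' = Sup (snd r)"
            note defs = this
            have q: "(fst q, snd q) \<in> p" "u < v" "(fst r, snd r) \<in> p" "u' < v'"
              using that by (auto simp: B_def defs)
            have "interior (snd q) \<inter> interior (snd r) = {}"
              using pD(5)[OF q(1,3)] that by (auto simp: prod_eq_iff)
            moreover have "snd q = {u..v}" "snd r = {u'..v'}"
              using Kint[OF q(1)] Kint[OF q(3)] by (auto simp: defs)
            ultimately have "{u<..<v} \<inter> {u'<..<v'} = {}" by simp
            then have "\<not> (max u u' < min v v')"
              using dense[of "max u u'" "min v v'"] by auto
            then show ?thesis using q by (auto simp: defs[symmetric])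
          qed
          have "(\<Sum>q\<in>B. Sup (snd q) - Inf (snd q)) = (\<Sum>(x,K)\<in>B. measure lborel K)"
            using K \<open>B \<subseteq> p\<close> by (intro sum.cong) auto
          also have "\<dots> \<le> measure lebesgue U"
          proof (rule sum_content_tagged_partial_division_le[OF _ U(3)])
            show "B tagged_partial_division_of cbox a b"
              using ptag \<open>B \<subseteq> p\<close> tagged_partial_division_subset tagged_division_of_def by blast
            show "K \<subseteq> U" if "(x, K) \<in> B" for x K
              using that K[of x K] d(2)[of x] by (auto simp: B_def)
          qed
          also have "\<dots> < \<delta>" by (rule U)
          finally show "(\<Sum>q\<in>B. Sup (snd q) - Inf (snd q)) < \<delta>" .
        qed
        then show ?thesis by (simp add: case_prod_unfold)
      qed
      moreover have "(\<Sum>(x,K)\<in>p-B. norm (measure lborel K *\<^sub>R g x - (f (Sup K) - f (Inf K)))) \<le> e / 2"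
      proof -
        have "(\<Sum>(x,K)\<in>p-B. norm (measure lborel K *\<^sub>R g x - (f (Sup K) - f (Inf K))))
            \<le> (\<Sum>(x,K)\<in>p-B. e' * (Sup K - Inf K))"
          using good by (intro sum_mono) auto
        also have "\<dots> \<le> (\<Sum>(x,K)\<in>p. e' * (Sup K - Inf K))"
          using K \<open>e' > 0\<close> fin by (intro sum_mono2) force+
        also have "\<dots> = e' * (b - a)"
          by (simp add: ba(1) sum_distrib_left case_prod_unfold)
        also have "\<dots> \<le> e / 2"
          using \<open>a \<le> b\<close> \<open>e > 0\<close> by (simp add: e'_def field_simps)
        finally show ?thesis .
      qed
      \<comment> \<open>The increments telescope to \<open>f b - f a\<close>, so the error is a sum
        over cells; on \<open>B\<close> the term with \<open>g\<close> is zero and only the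
        increment is left.\<close>
      moreover have "norm ((\<Sum>(x, k)\<in>p. measure lborel k *\<^sub>R g x) - (f b - f a)) \<le>
          (\<Sum>(x,K)\<in>B. norm (f (Sup K) - f (Inf K))) 
          + (\<Sum>(x,K)\<in>p-B. norm (measure lborel K *\<^sub>R g x - (f (Sup K) - f (Inf K))))"
      proof -
        have "norm ((\<Sum>(x, k)\<in>p. measure lborel k *\<^sub>R g x) - (f b - f a)) =
            norm (\<Sum>(x,K)\<in>p. measure lborel K *\<^sub>R g x - (f (Sup K) - f (Inf K)))"
          by (simp add: ba(2) sum_subtractf case_prod_unfold)
        also have "\<dots> \<le> (\<Sum>(x,K)\<in>p. norm (measure lborel K *\<^sub>R g x - (f (Sup K) - f (Inf K))))"
          by (rule sum_norm_le) auto
        also have "\<dots> = (\<Sum>(x,K)\<in>p-B. norm (measure lborel K *\<^sub>R g x - (f (Sup K) - f (Inf K)))) +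
            (\<Sum>(x,K)\<in>B. norm (measure lborel K *\<^sub>R g x - (f (Sup K) - f (Inf K))))"
          using fin by (intro sum.subset_diff)
        also have "(\<Sum>(x,K)\<in>B. norm (measure lborel K *\<^sub>R g x - (f (Sup K) - f (Inf K)))) 
           = (\<Sum>(x,K)\<in>B. norm (f (Sup K) - f (Inf K)))"
          by (intro sum.cong) (auto simp: B_def g_def norm_minus_commute)
        finally show ?thesis by simp
      qed
      ultimately show "norm ((\<Sum>(x, k)\<in>p. measure lborel k *\<^sub>R g x) - (f b - f a)) < e"
        by linarith
    qed
  qed
  then have "(g has_integral (f b - f a)) {a..b}" by simp
  then show ?thesis
    by (rule has_integral_spike[OF negl, rotated]) (auto simp: g_def)
qed

section \<open>Integrals of singular kernels\<close>

text \<open>On either side of \<open>c\<close> the integrand is a translate or a reflection of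
  \<open>x powr - a\<close> on \<open>{0..r}\<close>, whence the factor 2.\<close>

lemma nn_integral_abs_powr_le:
  fixes a r c :: real
  assumes "a < 1" "r \<ge> 0"
  shows "(\<integral>\<^sup>+x. ennreal (\<bar>x - c\<bar> powr - a) * indicator {c - r..c + r} x \<partial>lborel)
    \<le> ennreal (2 * (r powr (1 - a) / (1 - a)))"
proof -
  let ?g = "\<lambda>x. ennreal (x powr - a) * indicator {0..r} x"
  have "((\<lambda>x. x powr - a) has_integral (r powr (- a + 1) / (- a + 1))) {0..r}"
    using assms by (intro has_integral_powr_from_0) auto
  then have g: "integral\<^sup>N lborel ?g = ennreal (r powr (1 - a) / (1 - a))"
    using nn_integral_has_integral_lebesgue'[of "{0..r}" "\<lambda>x. x powr - a"] by simp
  have "(\<integral>\<^sup>+x. ennreal (\<bar>x - c\<bar> powr - a) * indicator {c - r..c + r} x \<partial>lborel)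
      \<le> (\<integral>\<^sup>+x. ?g (x - c) + ?g (c - x) \<partial>lborel)"
    by (intro nn_integral_mono) (auto simp: indicator_def)
  also have "\<dots> = (\<integral>\<^sup>+x. ?g (x - c) \<partial>lborel) + (\<integral>\<^sup>+x. ?g (c - x) \<partial>lborel)"
    by (rule nn_integral_add) auto
  also have "(\<integral>\<^sup>+x. ?g (x - c) \<partial>lborel) = integral\<^sup>N lborel ?g"
    using nn_integral_real_affine[of ?g 1 "-c"] by simp
  also have "(\<integral>\<^sup>+x. ?g (c - x) \<partial>lborel) = integral\<^sup>N lborel ?g"
    using nn_integral_real_affine[of ?g "-1" c] by simp
  also have "integral\<^sup>N lborel ?g + integral\<^sup>N lborel ?g = ennreal (2 * (r powr (1 - a) / (1 - a)))"
    using assms unfolding g by (subst ennreal_plus[symmetric]) auto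
  finally show ?thesis .
qed

text \<open>The modulus dominates both coordinates, so the kernel is at most a product of
  one-dimensional kernels with half the exponent. The value \<open>\<infinity>\<close> on the coordinate axes makes up
  for \<^term>\<open>(0::real) powr x = 0\<close>.\<close>

lemma nn_integral_ball_cmod_powr_le:
  fixes e r :: real and w :: complex
  assumes "0 \<le> e" "e < 2" "r \<ge> 0"
  shows "(\<integral>\<^sup>+z. ennreal (cmod (w - z) powr - e) * indicator (cball w r) z \<partial>lborel)
    \<le> ennreal ((2 * (r powr (1 - e / 2) / (1 - e / 2)))\<^sup>2)"
proof -
  define q :: "real \<Rightarrow> real \<Rightarrow> ennreal"
    where "q c x = (if x = c then \<infinity> else ennreal (\<bar>x - c\<bar> powr - (e / 2))) * indicator {c - r..c + r} x" for c x
  have q_meas [measurable]: "q c \<in> borel_measurable borel" for c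
    unfolding q_def by measurable
  let ?C = "2 * (r powr (1 - e / 2) / (1 - e / 2))"
  have C: "?C \<ge> 0" using assms by simp
  have qC: "(\<integral>\<^sup>+x. q c x \<partial>lborel) \<le> ennreal ?C" for c
  proof -
    have "(\<integral>\<^sup>+x. q c x \<partial>lborel) =
        (\<integral>\<^sup>+x. ennreal (\<bar>x - c\<bar> powr - (e / 2)) * indicator {c - r..c + r} x \<partial>lborel)"
      by (rule nn_integral_cong_AE, use AE_lborel_singleton[of c] in eventually_elim, simp add: q_def)
    also have "\<dots> \<le> ennreal ?C"
      using assms nn_integral_abs_powr_le[of "e / 2" r c] by simp
    finally show ?thesis .
  qed
  have "(\<integral>\<^sup>+z. ennreal (cmod (w - z) powr - e) * indicator (cball w r) z \<partial>lborel)
      \<le> (\<integral>\<^sup>+z. (\<Prod>b\<in>Basis. q (w \<bullet> b) (z \<bullet> b)) \<partial>lborel)"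
  proof (rule nn_integral_mono)
    fix z
    show "ennreal (cmod (w - z) powr - e) * indicator (cball w r) z \<le> (\<Prod>b\<in>Basis. q (w \<bullet> b) (z \<bullet> b))"
    proof (cases "z \<in> cball w r")
      case True
      define x y where "x = \<bar>Re z - Re w\<bar>" "y = \<bar>Im z - Im w\<bar>"
      have le: "x \<le> cmod (w - z)" "y \<le> cmod (w - z)"
        using abs_Re_le_cmod[of "w - z"] abs_Im_le_cmod[of "w - z"] by (auto simp: x_y_def)
      have r: "Re z \<in> {Re w - r..Re w + r}" "Im z \<in> {Im w - r..Im w + r}"
        using True le by (auto simp: x_y_def dist_norm)
      have prod: "(\<Prod>b\<in>Basis. q (w \<bullet> b) (z \<bullet> b)) = q (Re w) (Re z) * q (Im w) (Im z)"
        by (simp add: Basis_complex_def)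
      show ?thesis
      proof (cases "x = 0 \<or> y = 0")
        case True
        show ?thesis
        proof (cases "w = z")
          case False
          then have "x > 0 \<or> y > 0" by (auto simp: x_y_def complex_eq_iff)
          \<comment> \<open>The factor of the vanishing coordinate is infinite and the other one is
            positive; positivity matters because \<open>0 * \<infinity> = 0\<close> in
            \<open>ennreal\<close>.\<close>
          then have "q (Re w) (Re z) * q (Im w) (Im z) = \<infinity>"
            using True r by (auto simp: q_def x_y_def ennreal_mult_top ennreal_top_mult)
          then show ?thesis by (simp add: prod)
        qed auto
      next
        case False
        then have pos: "x > 0" "y > 0" by (auto simp: x_y_def)
        have "cmod (w - z) powr - e = cmod (w - z) powr - (e / 2) * cmod (w - z) powr - (e / 2)"
          by (simp flip: powr_add)
        also have "\<dots> \<le> x powr - (e / 2) * y powr - (e / 2)"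
          using pos le assms by (intro mult_mono powr_mono2') auto
        finally have "ennreal (cmod (w - z) powr - e) \<le> ennreal (x powr - (e / 2)) * ennreal (y powr - (e / 2))"
          by (simp flip: ennreal_mult')
        then show ?thesis
          unfolding prod using False r \<open>z \<in> cball w r\<close> by (auto simp: q_def x_y_def)
      qed
    qed simp
  qed
  also have "\<dots> = (\<Prod>b\<in>Basis. \<integral>\<^sup>+x. q (w \<bullet> b) x \<partial>lborel)"
    by (rule nn_integral_lborel_prod) auto
  also have "\<dots> = (\<integral>\<^sup>+x. q (Re w) x \<partial>lborel) * (\<integral>\<^sup>+x. q (Im w) x \<partial>lborel)"
    by (simp add: Basis_complex_def)
  also have "\<dots> \<le> ennreal ?C * ennreal ?C"
    by (intro mult_mono qC) auto
  also have "\<dots> = ennreal (?C\<^sup>2)"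
    using C by (simp add: power2_eq_square flip: ennreal_mult)
  finally show ?thesis .
qed

text \<open>Concavity on \<open>{0..pi}\<close> puts the sine above its chord from 0 to
  \<open>pi / 2\<close>, which has slope \<open>2 / pi\<close>.\<close>

lemma sin_ge_Jordan:
  assumes "0 \<le> x" "x \<le> pi / 2"
  shows "sin x \<ge> 2 / pi * x"
proof -
  have "concave_on {0..pi} sin"
    by (rule f''_le0_imp_concave[where f' = cos and f'' = "\<lambda>x. - sin x"])
      (auto intro!: derivative_eq_intros sin_ge_zero)
  from concave_onD[OF this, of "2 / pi * x" 0 "pi / 2"] show ?thesis
    using assms by (simp add: field_simps)
qed

text \<open>The minimum is the length of the shorter arc. With
  \<open>d = \<bar>\<theta> - \<alpha>\<bar>\<close> the chord has length
  \<open>2 * sin (d / 2)\<close>, and Jordan's inequality applies at \<open>d / 2\<close> or, for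
  \<open>d > pi\<close>, at \<open>pi - d / 2\<close>.\<close>

lemma cmod_cis_diff_ge:
  assumes "\<bar>\<theta> - \<alpha>\<bar> \<le> 2 * pi"
  shows "cmod (cis \<theta> - cis \<alpha>) \<ge> 2 / pi * min \<bar>\<theta> - \<alpha>\<bar> (2 * pi - \<bar>\<theta> - \<alpha>\<bar>)"
proof -
  define d where "d = \<bar>\<theta> - \<alpha>\<bar>"
  have d: "0 \<le> d" "d \<le> 2 * pi" using assms by (auto simp: d_def)
  have "(cmod (cis \<theta> - cis \<alpha>))\<^sup>2 = 2 - 2 * cos (\<theta> - \<alpha>)"
    using sin_cos_squared_add[of \<theta>] sin_cos_squared_add[of \<alpha>]
    by (simp add: cmod_power2 cos_diff power2_diff algebra_simps)
  also have "cos (\<theta> - \<alpha>) = cos (2 * (d / 2))"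
    by (simp add: d_def abs_if cos_diff)
  also have "2 - 2 * cos (2 * (d / 2)) = (2 * sin (d / 2))\<^sup>2"
    by (subst cos_double_sin) (simp add: power2_eq_square)
  finally have eq: "cmod (cis \<theta> - cis \<alpha>) = 2 * sin (d / 2)"
    using d by (subst (asm) power2_eq_iff_nonneg) (auto intro!: sin_ge_zero)
  show ?thesis
  proof (cases "d \<le> pi")
    case True
    then show ?thesis
      using sin_ge_Jordan[of "d / 2"] d by (simp add: eq flip: d_def)
  next
    case False
    have "sin (pi - d / 2) \<ge> 2 / pi * (pi - d / 2)"
      using False d by (intro sin_ge_Jordan) auto
    moreover have "sin (pi - d / 2) = sin (d / 2)"
      by (rule sin_pi_minus)
    ultimately show ?thesis
      using False d by (simp add: eq right_diff_distrib flip: d_def)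
  qed
qed

lemma circle_dist_ge:
  "1 - cmod z \<le> cmod (cis \<theta> - z)"
  using norm_triangle_ineq2[of "cis \<theta>" z] by simp

text \<open>The factor 3 counts the singular centres on the line, \<open>pi powr \<beta>\<close> is
  the cost of replacing distance by arc length, and the rest is the one-dimensional integral of
  radius \<open>4 * pi\<close>. The point of the disk does not enter.\<close>

definition circle_bound :: "real \<Rightarrow> real" where
  "circle_bound \<beta> = 3 * (pi powr \<beta> * (2 * ((4 * pi) powr (1 - \<beta>) / (1 - \<beta>))))"

text \<open>The radial projection \<open>cis \<alpha>\<close> of \<open>z\<close> is at distance
  \<open>1 - cmod z\<close>, which is at most \<open>cmod (cis \<theta> - z)\<close>. Hence the
  chord from \<open>cis \<theta>\<close> to \<open>cis \<alpha>\<close> is at most twice that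
  distance, and the kernel is controlled by the arc length \<open>m\<close> uniformly in
  \<open>z\<close>.\<close>

lemma nn_integral_circle_powr_le:
  fixes \<beta> :: real
  assumes "0 \<le> \<beta>" "\<beta> < 1" and z: "z \<in> ball 0 1"
  shows "(\<integral>\<^sup>+\<theta>. ennreal (cmod (cis \<theta> - z) powr - \<beta>) * indicator {0..2*pi} \<theta> \<partial>lborel)
    \<le> ennreal (circle_bound \<beta>)"
proof -
  define \<alpha> where "\<alpha> = Arg2pi z"
  have \<alpha>: "0 \<le> \<alpha>" "\<alpha> < 2 * pi" "z = of_real (cmod z) * cis \<alpha>"
    using Arg2pi[of z] Arg2pi_eq[of z] by (auto simp: \<alpha>_def cis_conv_exp)
  \<comment> \<open>The centres used lie in \<open>[-2 * pi, 4 * pi]\<close> and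
    \<open>\<theta>\<close> in \<open>[0, 2 * pi]\<close>, so radius \<open>4 * pi\<close> covers
    every case.\<close>
  define k where "k c \<theta> = ennreal (\<bar>\<theta> - c\<bar> powr - \<beta>) * indicator {c - 4 * pi..c + 4 * pi} \<theta>" for c \<theta> :: real
  have [measurable]: "k c \<in> borel_measurable borel" for c
    unfolding k_def by measurable
  have kC: "integral\<^sup>N lborel (k c) \<le> ennreal (2 * ((4 * pi) powr (1 - \<beta>) / (1 - \<beta>)))" for c
    unfolding k_def using assms by (intro nn_integral_abs_powr_le) auto
  \<comment> \<open>The centres themselves are excluded: there \<open>m = 0\<close>, and
    \<open>0 powr - \<beta> = 0\<close> is no upper bound.\<close>
  have AE: "AE \<theta> in lborel. ennreal (cmod (cis \<theta> - z) powr - \<beta>) * indicator {0..2*pi} \<theta>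
      \<le> ennreal (pi powr \<beta>) * (k \<alpha> \<theta> + k (\<alpha> - 2 * pi) \<theta> + k (\<alpha> + 2 * pi) \<theta>)"
    using AE_lborel_singleton[of \<alpha>] AE_lborel_singleton[of "\<alpha> - 2 * pi"] AE_lborel_singleton[of "\<alpha> + 2 * pi"]
  proof eventually_elim
    fix \<theta> :: real
    assume ne: "\<theta> \<noteq> \<alpha>" "\<theta> \<noteq> \<alpha> - 2 * pi" "\<theta> \<noteq> \<alpha> + 2 * pi"
    show "ennreal (cmod (cis \<theta> - z) powr - \<beta>) * indicator {0..2*pi} \<theta>
      \<le> ennreal (pi powr \<beta>) * (k \<alpha> \<theta> + k (\<alpha> - 2 * pi) \<theta> + k (\<alpha> + 2 * pi) \<theta>)"
    proof (cases "\<theta> \<in> {0..2*pi}")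
      case True
      define m where "m = min \<bar>\<theta> - \<alpha>\<bar> (2 * pi - \<bar>\<theta> - \<alpha>\<bar>)"
      have "cmod (cis \<theta> - cis \<alpha>) \<le> cmod (cis \<theta> - z) + cmod (z - cis \<alpha>)"
        by (metis diff_add_cancel add_diff_eq norm_triangle_ineq)
      also have "cmod (z - cis \<alpha>) = 1 - cmod z"
      proof -
        have "z - cis \<alpha> = of_real (cmod z - 1) * cis \<alpha>"
          by (subst \<alpha>(3)) (simp add: algebra_simps)
        then show ?thesis using z by (simp add: norm_mult del: of_real_diff)
      qed
      also have "1 - cmod z \<le> cmod (cis \<theta> - z)"
        by (rule circle_dist_ge)
      finally have "2 / pi * m \<le> 2 * cmod (cis \<theta> - z)"
        using cmod_cis_diff_ge[of \<theta> \<alpha>] True \<alpha>(1,2) unfolding m_def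
        by (smt (verit) atLeastAtMost_iff)
      then have m: "m / pi \<le> cmod (cis \<theta> - z)" by simp
      have "m > 0" using ne True \<alpha> by (auto simp: m_def)
      have "cmod (cis \<theta> - z) powr - \<beta> \<le> (m / pi) powr - \<beta>"
        using m \<open>m > 0\<close> assms by (intro powr_mono2') auto
      also have "\<dots> = pi powr \<beta> * m powr - \<beta>"
        using \<open>m > 0\<close> by (simp add: powr_divide powr_minus field_simps)
      finally have "ennreal (cmod (cis \<theta> - z) powr - \<beta>) \<le> ennreal (pi powr \<beta>) * ennreal (m powr - \<beta>)"
        by (simp flip: ennreal_mult')
      also have "ennreal (m powr - \<beta>) \<le> k \<alpha> \<theta> + k (\<alpha> - 2 * pi) \<theta> + k (\<alpha> + 2 * pi) \<theta>"
      proof -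
        have "m = \<bar>\<theta> - \<alpha>\<bar> \<or> m = \<bar>\<theta> - (\<alpha> - 2 * pi)\<bar> \<or> m = \<bar>\<theta> - (\<alpha> + 2 * pi)\<bar>"
          using True \<alpha> by (auto simp: m_def min_def abs_if)
        moreover have "k c \<theta> = ennreal (\<bar>\<theta> - c\<bar> powr - \<beta>)" if "-2 * pi \<le> c" "c \<le> 4 * pi" for c
          using that True by (auto simp: k_def)
        ultimately have "ennreal (m powr - \<beta>) \<in> {k \<alpha> \<theta>, k (\<alpha> - 2 * pi) \<theta>, k (\<alpha> + 2 * pi) \<theta>}"
          using \<alpha> by auto
        then show ?thesis
          by (auto simp: add_increasing add_increasing2)
      qed
      finally show ?thesis using True by (simp add: mult_left_mono)
    qed simp
  qed
  let ?C = "2 * ((4 * pi) powr (1 - \<beta>) / (1 - \<beta>))"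
  have C: "?C \<ge> 0" using assms by simp
  have "(\<integral>\<^sup>+\<theta>. ennreal (cmod (cis \<theta> - z) powr - \<beta>) * indicator {0..2*pi} \<theta> \<partial>lborel)
      \<le> (\<integral>\<^sup>+\<theta>. ennreal (pi powr \<beta>) * (k \<alpha> \<theta> + k (\<alpha> - 2 * pi) \<theta> + k (\<alpha> + 2 * pi) \<theta>) \<partial>lborel)"
    by (rule nn_integral_mono_AE[OF AE])
  also have "\<dots> = ennreal (pi powr \<beta>) * (integral\<^sup>N lborel (k \<alpha>) + integral\<^sup>N lborel (k (\<alpha> - 2 * pi))
      + integral\<^sup>N lborel (k (\<alpha> + 2 * pi)))"
    by (simp add: nn_integral_cmult nn_integral_add)
  also have "\<dots> \<le> ennreal (pi powr \<beta>) * (ennreal ?C + ennreal ?C + ennreal ?C)"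
    by (intro mult_left_mono add_mono kC) auto
  also have "\<dots> = ennreal (3 * (pi powr \<beta> * ?C))"
    using C by (simp flip: ennreal_plus ennreal_mult' add: algebra_simps)
  finally show ?thesis by (simp only: circle_bound_def)
qed

section \<open>The Cauchy transform of an Lp function\<close>

text \<open>A convex function lies above its tangents. Convexity and the derivative are used on the
  open half-line; at \<open>x = 0\<close> the right side is \<open>(1 - p) * m powr p\<close>, which
  is not positive.\<close>

lemma powr_ge_tangent:
  fixes p x m :: real
  assumes "p \<ge> 1" "x \<ge> 0" "m > 0"
  shows "x powr p \<ge> m powr p + p * m powr (p - 1) * (x - m)"
proof (cases "x = 0")
  case True
  have "m powr p = m powr (p - 1) * m"
    using assms by (simp add: powr_diff)
  then show ?thesis using True assms by (simp add: mult_right_mono mult_left_mono)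
next
  case False
  have "(\<lambda>x. x powr p) x - m powr p \<ge> (p * m powr (p - 1)) * (x - m)"
    using False assms
    by (intro convex_on_imp_above_tangent[where A = "{0<..}"] powr_convex)
      (auto intro!: derivative_eq_intros simp: interior_open)
  then show ?thesis by simp
qed

text \<open>Jensen's inequality for \<open>f / K\<close> under the measure with density
  \<open>K\<close>, whose lack of normalisation produces the first factor. The tangent inequality is
  taken at the mean \<open>m\<close> of \<open>f / K\<close>, multiplied by \<open>K\<close> and
  integrated.\<close>

lemma weighted_Jensen_powr:
  fixes f K :: "'a \<Rightarrow> real"
  assumes p: "p \<ge> 1" and f: "integrable M f" "\<And>x. x \<in> space M \<Longrightarrow> f x \<ge> 0"
    and K: "integrable M K" "\<And>x. x \<in> space M \<Longrightarrow> K x > 0"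
    and fK: "integrable M (\<lambda>x. f x powr p * K x powr (1 - p))"
  shows "(\<integral>x. f x \<partial>M) powr p \<le> (\<integral>x. K x \<partial>M) powr (p - 1) * (\<integral>x. f x powr p * K x powr (1 - p) \<partial>M)"
proof (cases "(\<integral>x. f x \<partial>M) = 0")
  case True
  then show ?thesis using p by (auto intro!: mult_nonneg_nonneg integral_nonneg_AE)
next
  case False
  define I J m where "I = (\<integral>x. f x \<partial>M)" and "J = (\<integral>x. K x \<partial>M)" and "m = I / J"
  have "I > 0"
    using False f by (auto simp: I_def less_le intro!: Bochner_Integration.integral_nonneg)
  \<comment> \<open>Since \<open>K > 0\<close> everywhere, \<open>J = 0\<close> would make the whole
    space null and force the integral of \<open>f\<close> to vanish.\<close>
  have "J \<noteq> 0"
  proof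
    assume "J = 0"
    then have "AE x in M. K x = 0"
      using K integral_nonneg_eq_0_iff_AE[OF K(1)] by (auto simp: J_def less_imp_le)
    then have "AE x in M. f x = 0"
      by (rule AE_mp) (use K(2) in \<open>auto intro!: AE_I2\<close>, force)
    then show False
      using False integral_eq_zero_AE by blast
  qed
  moreover have "J \<ge> 0"
    using K by (auto simp: J_def less_imp_le intro!: Bochner_Integration.integral_nonneg)
  ultimately have "J > 0" by simp
  then have "m > 0" using \<open>I > 0\<close> by (simp add: m_def)
  have tangent: "f x powr p * K x powr (1 - p) \<ge> m powr p * K x + p * m powr (p - 1) * (f x - m * K x)"
    if "x \<in> space M" for x
  proof -
    have Kx: "K x > 0" and fx: "f x \<ge> 0" using that f K by auto
    have "K x * (m powr p + p * m powr (p - 1) * (f x / K x - m)) \<le> K x * (f x / K x) powr p"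
      using Kx fx p \<open>m > 0\<close> by (intro mult_left_mono powr_ge_tangent) auto
    also have "\<dots> = f x powr p * K x powr (1 - p)"
      using Kx fx by (simp add: powr_divide powr_diff)
    also have "K x * (m powr p + p * m powr (p - 1) * (f x / K x - m)) =
        m powr p * K x + p * m powr (p - 1) * (f x - m * K x)"
      using Kx by (simp add: field_simps)
    finally show ?thesis .
  qed
  \<comment> \<open>The linear term integrates to zero because \<open>I = m * J\<close>; the factor
    \<open>J powr (p - 1)\<close> then turns \<open>m powr p * J\<close> into
    \<open>I powr p\<close>.\<close>
  have "m powr p * J = (\<integral>x. m powr p * K x + p * m powr (p - 1) * (f x - m * K x) \<partial>M)"
    using f K \<open>J > 0\<close> by (simp add: m_def flip: I_def J_def)
  also have "\<dots> \<le> (\<integral>x. f x powr p * K x powr (1 - p) \<partial>M)"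
    using f K fK tangent by (intro integral_mono) auto
  finally have "J powr (p - 1) * (m powr p * J) \<le> J powr (p - 1) * (\<integral>x. f x powr p * K x powr (1 - p) \<partial>M)"
    by (rule mult_left_mono) simp
  moreover have "J powr (p - 1) * (m powr p * J) = I powr p"
    using \<open>I > 0\<close> \<open>J > 0\<close> by (simp add: m_def powr_divide powr_diff)
  ultimately show ?thesis by (simp add: I_def J_def)
qed


lemma continuous_on_circle_dist_powr:
  assumes "z \<in> ball 0 1"
  shows "continuous_on S (\<lambda>\<theta>. cmod (cis \<theta> - z) powr s)"
proof -
  have "cmod (cis \<theta> - z) \<noteq> 0" for \<theta>
    using circle_dist_ge[of z \<theta>] assms by auto
  then show ?thesis by (intro continuous_intros) auto
qed

text \<open>The exponents satisfy \<open>p = e + \<beta> (p - 1)\<close>; \<open>\<beta> < 1\<close> keeps the weight integrable over the circle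
  uniformly in \<open>z\<close>, and \<open>e < 2\<close> keeps the remaining kernel integrable over the disk.\<close>

lemma norm_cauchy_transform_powr_le:
  fixes g :: "real \<Rightarrow> complex" and p :: real
  defines "\<beta> \<equiv> 1 - 1 / (2 * p)" and "e \<equiv> 3 / 2 - 1 / (2 * p)" and "M \<equiv> lebesgue_on {0..2*pi}"
  assumes p: "p \<ge> 1" and z: "z \<in> ball 0 1"
    and g: "g \<in> borel_measurable M" "integrable M (\<lambda>\<theta>. norm (g \<theta>) powr p)"
  shows "integrable M (\<lambda>\<theta>. norm (g \<theta>) powr p * cmod (cis \<theta> - z) powr - e)"
    and "norm (integral {0..2*pi} (\<lambda>\<theta>. g \<theta> / (cis \<theta> - z))) powr p
      \<le> circle_bound \<beta> powr (p - 1) * (\<integral>\<theta>. norm (g \<theta>) powr p * cmod (cis \<theta> - z) powr - e \<partial>M)"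
proof -
  define D where "D \<theta> = cmod (cis \<theta> - z)" for \<theta>
  \<comment> \<open>For fixed \<open>z\<close> this crude lower bound on the distance serves only to
    establish integrability; it does not enter the final estimate.\<close>
  define \<rho> where "\<rho> = 1 - cmod z"
  have "\<rho> > 0" using z by (simp add: \<rho>_def)
  have D: "D \<theta> \<ge> \<rho>" "D \<theta> > 0" for \<theta>
    using circle_dist_ge[of z \<theta>] \<open>\<rho> > 0\<close> by (auto simp: D_def \<rho>_def)
  have contD: "continuous_on {0..2*pi} (\<lambda>\<theta>. D \<theta> powr s)" for s
    unfolding D_def by (rule continuous_on_circle_dist_powr[OF z])
  have [measurable]: "(\<lambda>\<theta>. D \<theta> powr s) \<in> borel_measurable M" for s
    unfolding M_def by (intro continuous_imp_measurable_on_sets_lebesgue contD) auto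
  note g(1) [measurable]
  interpret finite_measure M
    by (rule finite_measureI) (simp add: M_def emeasure_restrict_space)
  have \<beta>: "0 \<le> \<beta>" "\<beta> < 1" and e: "0 \<le> e"
    using p by (auto simp: \<beta>_def e_def field_simps)
  have bound: "D \<theta> powr - s \<le> \<rho> powr - s" if "s \<ge> 0" for s \<theta>
    using that D(1)[of \<theta>] \<open>\<rho> > 0\<close> by (intro powr_mono2') auto
  have int_e: "integrable M (\<lambda>\<theta>. norm (g \<theta>) powr p * D \<theta> powr - e)"
  proof (rule Bochner_Integration.integrable_bound)
    show "integrable M (\<lambda>\<theta>. norm (g \<theta>) powr p * \<rho> powr - e)"
      using g(2) by simp
  qed (use bound[OF e] in \<open>auto simp: mult_left_mono\<close>)
  then show "integrable M (\<lambda>\<theta>. norm (g \<theta>) powr p * cmod (cis \<theta> - z) powr - e)"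
    by (simp add: D_def)
  have int_1: "integrable M (\<lambda>\<theta>. norm (g \<theta>) * D \<theta> powr - 1)"
  proof (rule Bochner_Integration.integrable_bound)
    show "integrable M (\<lambda>\<theta>. (1 + norm (g \<theta>) powr p) * \<rho> powr - 1)"
      using g(2) by simp
    \<comment> \<open>On a finite measure space this makes an Lp function integrable.\<close>
    have "x \<le> 1 + x powr p" if "x \<ge> 0" for x :: real
      using powr_mono[of 1 p x] p that by (cases "x \<ge> 1") (auto simp: add_increasing2)
    then have "norm (norm (g \<theta>) * D \<theta> powr - 1) \<le> norm ((1 + norm (g \<theta>) powr p) * \<rho> powr - 1)" for \<theta>
      using bound[of 1 \<theta>] mult_mono[of "norm (g \<theta>)" "1 + norm (g \<theta>) powr p" "D \<theta> powr - 1" "\<rho> powr - 1"]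
      by (simp add: abs_mult)
    then show "AE \<theta> in M. norm (norm (g \<theta>) * D \<theta> powr - 1) \<le> norm ((1 + norm (g \<theta>) powr p) * \<rho> powr - 1)"
      by blast
  qed measurable
  have int_\<beta>: "integrable M (\<lambda>\<theta>. D \<theta> powr - \<beta>)"
    using continuous_imp_integrable_real[OF contD] by (simp add: M_def)
  have "(\<integral>\<theta>. D \<theta> powr - \<beta> \<partial>M) \<le> circle_bound \<beta>"
  proof -
    have "ennreal (\<integral>\<theta>. D \<theta> powr - \<beta> \<partial>M) = (\<integral>\<^sup>+\<theta>. ennreal (D \<theta> powr - \<beta>) \<partial>M)"
      using int_\<beta> by (intro nn_integral_eq_integral[symmetric]) auto
    also have "\<dots> = (\<integral>\<^sup>+\<theta>. ennreal (D \<theta> powr - \<beta>) * indicator {0..2*pi} \<theta> \<partial>lborel)"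
      unfolding M_def by (subst nn_integral_restrict_space) (auto simp: nn_integral_completion)
    also have "\<dots> \<le> ennreal (circle_bound \<beta>)"
      unfolding D_def using \<beta> z by (rule nn_integral_circle_powr_le)
    finally show ?thesis
      using \<beta> by (subst (asm) ennreal_le_iff) (auto simp: circle_bound_def)
  qed
  moreover have "(\<integral>\<theta>. D \<theta> powr - \<beta> \<partial>M) \<ge> 0"
    by simp
  ultimately have K: "(\<integral>\<theta>. D \<theta> powr - \<beta> \<partial>M) powr (p - 1) \<le> circle_bound \<beta> powr (p - 1)"
    using p by (intro powr_mono2) auto
  have exponent: "- p - \<beta> * (1 - p) = - e"
    using p by (simp add: \<beta>_def e_def field_simps)
  have eq: "(norm (g \<theta>) * D \<theta> powr - 1) powr p * (D \<theta> powr - \<beta>) powr (1 - p) = norm (g \<theta>) powr p * D \<theta> powr - e" for \<theta>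
  proof -
    have "(norm (g \<theta>) * D \<theta> powr - 1) powr p * (D \<theta> powr - \<beta>) powr (1 - p)
       = norm (g \<theta>) powr p * (D \<theta> powr - p * D \<theta> powr (- \<beta> * (1 - p)))"
      using D(2)[of \<theta>] by (simp add: powr_divide powr_powr powr_minus_divide)
    also have "D \<theta> powr - p * D \<theta> powr (- \<beta> * (1 - p)) = D \<theta> powr - e"
      by (subst powr_add[symmetric]) (simp flip: exponent)
    finally show ?thesis .
  qed
  have norm_eq: "norm (g \<theta> / (cis \<theta> - z)) = norm (g \<theta>) * D \<theta> powr - 1" for \<theta>
    using D(2)[of \<theta>] by (simp add: norm_divide powr_minus_divide flip: D_def)
  have "(\<lambda>\<theta>. cis \<theta> - z) \<in> borel_measurable M"
    unfolding M_def by (intro continuous_imp_measurable_on_sets_lebesgue continuous_intros) auto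
  then have [measurable]: "(\<lambda>\<theta>. g \<theta> / (cis \<theta> - z)) \<in> borel_measurable M"
    by measurable
  have int_T: "integrable M (\<lambda>\<theta>. g \<theta> / (cis \<theta> - z))"
    by (rule Bochner_Integration.integrable_bound[OF int_1]) (auto simp: norm_eq)
  have "norm (integral {0..2*pi} (\<lambda>\<theta>. g \<theta> / (cis \<theta> - z))) = norm (\<integral>\<theta>. g \<theta> / (cis \<theta> - z) \<partial>M)"
    using int_T by (simp add: M_def lebesgue_integral_eq_integral)
  also have "\<dots> \<le> (\<integral>\<theta>. norm (g \<theta>) * D \<theta> powr - 1 \<partial>M)"
    using integral_norm_bound[of M "\<lambda>\<theta>. g \<theta> / (cis \<theta> - z)"] by (simp only: norm_eq)
  finally have "norm (integral {0..2*pi} (\<lambda>\<theta>. g \<theta> / (cis \<theta> - z))) powr p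
      \<le> (\<integral>\<theta>. norm (g \<theta>) * D \<theta> powr - 1 \<partial>M) powr p"
    using p by (intro powr_mono2) auto
  \<comment> \<open>Jensen is applied to \<open>norm (g \<theta>) / D \<theta>\<close> with weight
    \<open>D \<theta> powr - \<beta>\<close>; the powers of \<open>D\<close> combine to the exponent
    \<open>- e\<close>.\<close>
  also have "\<dots> \<le> (\<integral>\<theta>. D \<theta> powr - \<beta> \<partial>M) powr (p - 1) *
      (\<integral>\<theta>. (norm (g \<theta>) * D \<theta> powr - 1) powr p * (D \<theta> powr - \<beta>) powr (1 - p) \<partial>M)"
  proof (rule weighted_Jensen_powr[OF p int_1 _ int_\<beta>])
    show "0 < D \<theta> powr - \<beta>" for \<theta>
      using D(2)[of \<theta>] by simp
    show "integrable M (\<lambda>\<theta>. (norm (g \<theta>) * D \<theta> powr - 1) powr p * (D \<theta> powr - \<beta>) powr (1 - p))"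
      using int_e by (simp only: eq)
  qed auto
  also have "\<dots> \<le> circle_bound \<beta> powr (p - 1) * (\<integral>\<theta>. norm (g \<theta>) powr p * D \<theta> powr - e \<partial>M)"
    unfolding eq by (intro mult_right_mono K Bochner_Integration.integral_nonneg) auto
  finally show "norm (integral {0..2*pi} (\<lambda>\<theta>. g \<theta> / (cis \<theta> - z))) powr p
      \<le> circle_bound \<beta> powr (p - 1) * (\<integral>\<theta>. norm (g \<theta>) powr p * cmod (cis \<theta> - z) powr - e \<partial>M)"
    by (simp add: D_def)
qed

text \<open>After the order of integration is exchanged, the kernel integrates over the disk to at
  most \<open>A\<close> for every \<open>\<theta>\<close>, which leaves a constant times the
  integral of \<open>norm (g \<theta>) powr p\<close>.\<close>

lemma nn_integral_cauchy_transform_powr_finite: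
  fixes g :: "real \<Rightarrow> complex" and p :: real
  assumes p: "p \<ge> 1"
    and g: "g \<in> borel_measurable (lebesgue_on {0..2*pi})"
      "integrable (lebesgue_on {0..2*pi}) (\<lambda>\<theta>. norm (g \<theta>) powr p)"
  shows "(\<integral>\<^sup>+z. ennreal (norm (integral {0..2*pi} (\<lambda>\<theta>. g \<theta> / (cis \<theta> - z))) powr p)
    * indicator (ball 0 1) z \<partial>lborel) < \<infinity>"
proof -
  let ?M = "lebesgue_on {0..2*pi}"
  define e where "e = 3 / 2 - 1 / (2 * p)"
  define C where "C = circle_bound (1 - 1 / (2 * p)) powr (p - 1)"
  \<comment> \<open>Radius 2 is enough, since a closed disk of that radius about any point of the
    unit circle contains the unit disk.\<close>
  define A where "A = (2 * (2 powr (1 - e / 2) / (1 - e / 2)))\<^sup>2"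
  have e: "0 \<le> e" "e < 2" using p by (auto simp: e_def field_simps)
  define u where "u \<theta> = indicator {0..2*pi} \<theta> * norm (g \<theta>) powr p" for \<theta> :: real
  have u: "integrable lebesgue u"
    using g(2) unfolding u_def by (subst (asm) integrable_restrict_space) auto
  \<comment> \<open>Tonelli's theorem is used for Borel measure, whereas \<open>g\<close> is only
    Lebesgue measurable; hence the passage to a Borel function equal to \<open>u\<close> almost
    everywhere.\<close>
  then obtain h where h [measurable]: "h \<in> borel_measurable borel" and uh: "AE \<theta> in lborel. u \<theta> = h \<theta>"
    using completion_ex_borel_measurable_real[of u lborel] by (auto dest: borel_measurable_integrable)
  have h_fin: "(\<integral>\<^sup>+\<theta>. ennreal (h \<theta>) \<partial>lborel) < \<infinity>"
  proof -
    have "(\<integral>\<^sup>+\<theta>. ennreal (h \<theta>) \<partial>lborel) = (\<integral>\<^sup>+\<theta>. ennreal (u \<theta>) \<partial>lborel)"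
      using uh by (intro nn_integral_cong_AE) auto
    also have "\<dots> = (\<integral>\<^sup>+\<theta>. ennreal (u \<theta>) \<partial>lebesgue)"
      by (simp add: nn_integral_completion)
    also have "\<dots> < \<infinity>"
      using u by (subst nn_integral_eq_integral) (auto simp: u_def)
    finally show ?thesis .
  qed
  have point: "ennreal (norm (integral {0..2*pi} (\<lambda>\<theta>. g \<theta> / (cis \<theta> - z))) powr p)
      \<le> ennreal C * (\<integral>\<^sup>+\<theta>. ennreal (h \<theta>) * ennreal (cmod (cis \<theta> - z) powr - e) \<partial>lborel)"
    if z: "z \<in> ball 0 1" for z
  proof -
    note * = norm_cauchy_transform_powr_le[OF p z g, folded e_def C_def]
    have "ennreal (norm (integral {0..2*pi} (\<lambda>\<theta>. g \<theta> / (cis \<theta> - z))) powr p)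
       \<le> ennreal C * ennreal (\<integral>\<theta>. norm (g \<theta>) powr p * cmod (cis \<theta> - z) powr - e \<partial>?M)"
      using *(2) by (subst ennreal_mult'[symmetric]) (auto simp: C_def intro!: ennreal_leI Bochner_Integration.integral_nonneg)
    also have "ennreal (\<integral>\<theta>. norm (g \<theta>) powr p * cmod (cis \<theta> - z) powr - e \<partial>?M)
        = (\<integral>\<^sup>+\<theta>. ennreal (norm (g \<theta>) powr p * cmod (cis \<theta> - z) powr - e) \<partial>?M)"
      using *(1) by (intro nn_integral_eq_integral[symmetric]) auto
    also have "\<dots> = (\<integral>\<^sup>+\<theta>. ennreal (norm (g \<theta>) powr p * cmod (cis \<theta> - z) powr - e) * indicator {0..2*pi} \<theta> \<partial>lborel)"
      by (subst nn_integral_restrict_space) (auto simp: nn_integral_completion)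
    also have "\<dots> = (\<integral>\<^sup>+\<theta>. ennreal (h \<theta>) * ennreal (cmod (cis \<theta> - z) powr - e) \<partial>lborel)"
    proof (rule nn_integral_cong_AE, use uh in eventually_elim)
      fix \<theta> assume "u \<theta> = h \<theta>"
      then show "ennreal (norm (g \<theta>) powr p * cmod (cis \<theta> - z) powr - e) * indicator {0..2*pi} \<theta> =
          ennreal (h \<theta>) * ennreal (cmod (cis \<theta> - z) powr - e)"
        by (auto simp: u_def indicator_def ennreal_mult' split: if_splits)
    qed
    finally show ?thesis .
  qed
  have [measurable]: "cis \<in> borel_measurable borel"
    by (intro borel_measurable_continuous_onI continuous_intros)
  have [measurable]: "ball (0::complex) 1 \<in> sets borel"
    by simp
  have "(\<integral>\<^sup>+z. ennreal (norm (integral {0..2*pi} (\<lambda>\<theta>. g \<theta> / (cis \<theta> - z))) powr p)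
      * indicator (ball 0 1) z \<partial>lborel)
      \<le> (\<integral>\<^sup>+z. \<integral>\<^sup>+\<theta>. ennreal C * (ennreal (h \<theta>) * ennreal (cmod (cis \<theta> - z) powr - e) * indicator (ball 0 1) z) \<partial>lborel \<partial>lborel)"
  proof (rule nn_integral_mono)
    fix z :: complex
    show "ennreal (norm (integral {0..2*pi} (\<lambda>\<theta>. g \<theta> / (cis \<theta> - z))) powr p) * indicator (ball 0 1) z
      \<le> (\<integral>\<^sup>+\<theta>. ennreal C * (ennreal (h \<theta>) * ennreal (cmod (cis \<theta> - z) powr - e) * indicator (ball 0 1) z) \<partial>lborel)"
      using point[of z] by (cases "z \<in> ball 0 1") (auto simp: nn_integral_cmult)
  qed
  also have "\<dots> = (\<integral>\<^sup>+\<theta>. \<integral>\<^sup>+z. ennreal C * (ennreal (h \<theta>) * ennreal (cmod (cis \<theta> - z) powr - e) * indicator (ball 0 1) z) \<partial>lborel \<partial>lborel)"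
    by (rule lborel_pair.Fubini') measurable
  also have "\<dots> = (\<integral>\<^sup>+\<theta>. ennreal C * (ennreal (h \<theta>) * (\<integral>\<^sup>+z. ennreal (cmod (cis \<theta> - z) powr - e) * indicator (ball 0 1) z \<partial>lborel)) \<partial>lborel)"
    by (simp add: nn_integral_cmult mult.assoc)
  also have "\<dots> \<le> (\<integral>\<^sup>+\<theta>. ennreal C * (ennreal (h \<theta>) * ennreal A) \<partial>lborel)"
  proof (intro nn_integral_mono mult_left_mono)
    fix \<theta> :: real
    have "ball 0 1 \<subseteq> cball (cis \<theta>) 2"
    proof
      fix z :: complex assume "z \<in> ball 0 1"
      then show "z \<in> cball (cis \<theta>) 2"
        using norm_triangle_ineq4[of "cis \<theta>" z] by (simp add: dist_norm)
    qed
    then have "(\<integral>\<^sup>+z. ennreal (cmod (cis \<theta> - z) powr - e) * indicator (ball 0 1) z \<partial>lborel)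
        \<le> (\<integral>\<^sup>+z. ennreal (cmod (cis \<theta> - z) powr - e) * indicator (cball (cis \<theta>) 2) z \<partial>lborel)"
      by (intro nn_integral_mono mult_left_mono) (auto simp: indicator_def)
    also have "\<dots> \<le> ennreal A"
      unfolding A_def using e by (intro nn_integral_ball_cmod_powr_le) auto
    finally show "(\<integral>\<^sup>+z. ennreal (cmod (cis \<theta> - z) powr - e) * indicator (ball 0 1) z \<partial>lborel) \<le> ennreal A" .
  qed auto
  also have "\<dots> = ennreal C * ((\<integral>\<^sup>+\<theta>. ennreal (h \<theta>) \<partial>lborel) * ennreal A)"
    by (simp add: nn_integral_cmult nn_integral_multc)
  also have "\<dots> < \<infinity>"
    using h_fin by (simp add: ennreal_mult_less_top)
  finally show ?thesis .
qed

section \<open>Derivatives of the Poisson integral\<close>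

lemma cis_diff_nonzero: "z \<in> ball 0 1 \<Longrightarrow> cis \<theta> - z \<noteq> 0"
  using circle_dist_ge[of z \<theta>] by auto

lemma one_minus_mult_cis: "1 - z * cis (- \<theta>) = cis (- \<theta>) * (cis \<theta> - z)"
  by (simp add: algebra_simps cis_mult)

text \<open>Up to the factor \<open>2 * pi\<close>, the Szego projection: expanding the kernel as a
  geometric series in \<open>z\<close> keeps exactly the Fourier coefficients of \<open>G\<close>
  with nonnegative index.\<close>

definition szego_integral :: "(real \<Rightarrow> complex) \<Rightarrow> complex \<Rightarrow> complex" where
  "szego_integral G z = integral {0..2*pi} (\<lambda>\<theta>. G \<theta> / (1 - z * cis (- \<theta>)))"

text \<open>Differentiation under the integral sign. The kernel is rewritten so as to be
  \<open>\<i>\<close> times the \<open>\<theta>\<close>-derivative of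
  \<open>1 / (cis \<theta> - z)\<close>, ready for integration by parts.\<close>

lemma has_field_derivative_szego_integral:
  assumes G: "continuous_on {0..2*pi} G" and z: "z \<in> ball 0 1"
  shows "(szego_integral G has_field_derivative
    integral {0..2*pi} (\<lambda>\<theta>. G \<theta> * (cis \<theta> / (cis \<theta> - z)\<^sup>2))) (at z)"
proof -
  have nz: "1 - w * cis (- \<theta>) \<noteq> 0" if "w \<in> ball 0 1" for w \<theta>
    using cis_diff_nonzero[OF that, of \<theta>] by (simp add: one_minus_mult_cis)
  have "((\<lambda>z. integral (cbox 0 (2*pi)) (\<lambda>\<theta>. G \<theta> / (1 - z * cis (- \<theta>)))) has_field_derivative
      integral (cbox 0 (2*pi)) (\<lambda>\<theta>. G \<theta> * cis (- \<theta>) / (1 - z * cis (- \<theta>))\<^sup>2)) (at z within ball 0 1)"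
  proof (rule leibniz_rule_field_derivative)
    show "((\<lambda>x. G t / (1 - x * cis (- t))) has_field_derivative G t * cis (- t) / (1 - x * cis (- t))\<^sup>2)
        (at x within ball 0 1)" if "x \<in> ball 0 1" for x t
      using nz[OF that, of t] by (auto intro!: derivative_eq_intros simp: power2_eq_square)
    show "(\<lambda>\<theta>. G \<theta> / (1 - x * cis (- \<theta>))) integrable_on cbox 0 (2 * pi)" if "x \<in> ball 0 1" for x
      using G nz[OF that] by (intro integrable_continuous continuous_intros) auto
    show "continuous_on (ball 0 1 \<times> cbox 0 (2 * pi)) (\<lambda>(x, t). G t * cis (- t) / (1 - x * cis (- t))\<^sup>2)"
      unfolding case_prod_unfold
      using nz by (intro continuous_intros continuous_on_compose2[OF G]) auto
  qed (use z in auto)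
  moreover have "G \<theta> * cis (- \<theta>) / (1 - z * cis (- \<theta>))\<^sup>2 = G \<theta> * (cis \<theta> / (cis \<theta> - z)\<^sup>2)" for \<theta>
    using cis_diff_nonzero[OF z, of \<theta>] unfolding one_minus_mult_cis cis_inverse[symmetric]
    by (simp add: power2_eq_square divide_simps)
  ultimately show ?thesis
    using z by (simp add: szego_integral_def[abs_def] at_within_open[of z "ball 0 1"])
qed

text \<open>The product of \<open>G\<close> and \<open>1 / (cis \<theta> - z)\<close> is absolutely
  continuous and takes equal values at both ends, so the integral of its derivative is zero.\<close>

lemma integral_by_parts_cauchy_kernel:
  assumes ac: "abs_continuous_on 0 (2*pi) G" and per: "G 0 = G (2 * pi)"
    and deriv: "AE \<theta> in lborel. \<theta> \<in> {0..2*pi} \<longrightarrow> (G has_vector_derivative g \<theta>) (at \<theta>)"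
    and z: "z \<in> ball 0 1"
  shows "integral {0..2*pi} (\<lambda>\<theta>. G \<theta> * (cis \<theta> / (cis \<theta> - z)\<^sup>2))
    = - \<i> * integral {0..2*pi} (\<lambda>\<theta>. g \<theta> / (cis \<theta> - z))"
proof -
  define \<psi> where "\<psi> \<theta> = 1 / (cis \<theta> - z)" for \<theta>
  define \<psi>' where "\<psi>' \<theta> = - \<i> * (cis \<theta> / (cis \<theta> - z)\<^sup>2)" for \<theta>
  \<comment> \<open>Bounds the norm of \<open>\<psi>'\<close>, because the distance from
    \<open>z\<close> to the circle is \<open>1 - cmod z\<close>.\<close>
  define L where "L = 1 / (1 - cmod z)\<^sup>2"
  note nz = cis_diff_nonzero[OF z]
  have d\<psi>: "(\<psi> has_vector_derivative \<psi>' \<theta>) (at \<theta> within S)" for \<theta> S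
  proof -
    have "((\<lambda>w. 1 / (w - z)) has_field_derivative - 1 / (cis \<theta> - z)\<^sup>2) (at (cis \<theta>))"
      using nz[of \<theta>] by (auto intro!: derivative_eq_intros simp: power2_eq_square)
    moreover have "(cis has_vector_derivative \<i> * cis \<theta>) (at \<theta>)"
      unfolding has_vector_derivative_def by (auto intro!: derivative_eq_intros)
    ultimately have "((\<lambda>w. 1 / (w - z)) \<circ> cis has_vector_derivative (\<i> * cis \<theta>) * (- 1 / (cis \<theta> - z)\<^sup>2)) (at \<theta>)"
      by (intro field_vector_diff_chain_at)
    then show ?thesis
      by (auto simp: \<psi>_def[abs_def] \<psi>'_def o_def intro: has_vector_derivative_at_within)
  qed
  have lip: "L-lipschitz_on {0..2*pi} \<psi>"
  proof (rule bounded_derivative_imp_lipschitz)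
    fix \<theta> :: real
    show "(\<psi> has_derivative (\<lambda>h. h *\<^sub>R \<psi>' \<theta>)) (at \<theta> within {0..2*pi})"
      using d\<psi> by (simp add: has_vector_derivative_def)
    have "norm (\<psi>' \<theta>) \<le> L"
    proof -
      have "(1 - cmod z)\<^sup>2 \<le> (cmod (cis \<theta> - z))\<^sup>2"
        using z circle_dist_ge[of z \<theta>] by (intro power_mono) auto
      then show ?thesis
        using z by (auto simp: \<psi>'_def L_def norm_mult norm_divide norm_power intro!: divide_left_mono mult_pos_pos nz)
    qed
    then show "onorm (\<lambda>h. h *\<^sub>R \<psi>' \<theta>) \<le> L"
      by (intro onorm_le) (simp add: mult.commute[of L] mult_left_mono)
  qed (auto simp: L_def)
  have "((\<lambda>\<theta>. G \<theta> * \<psi>' \<theta> + g \<theta> * \<psi> \<theta>) has_integral (G (2 * pi) * \<psi> (2 * pi) - G 0 * \<psi> 0)) {0..2*pi}"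
  proof (rule fundamental_theorem_of_calculus_abs_continuous)
    show "abs_continuous_on 0 (2 * pi) (\<lambda>\<theta>. G \<theta> * \<psi> \<theta>)"
      by (rule abs_continuous_on_mult_Lipschitz[OF ac lip])
    show "AE \<theta> in lborel. \<theta> \<in> {0..2 * pi} \<longrightarrow> ((\<lambda>\<theta>. G \<theta> * \<psi> \<theta>) has_vector_derivative
        G \<theta> * \<psi>' \<theta> + g \<theta> * \<psi> \<theta>) (at \<theta> within {0..2*pi})"
      using deriv by eventually_elim (auto intro!: has_vector_derivative_mult d\<psi> intro: has_vector_derivative_at_within)
  qed auto
  then have 1: "((\<lambda>\<theta>. G \<theta> * \<psi>' \<theta> + g \<theta> * \<psi> \<theta>) has_integral 0) {0..2*pi}"
    by (simp add: per \<psi>_def)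
  \<comment> \<open>This summand is integrable by continuity, so subtracting it gives both the
    existence and the value of the integral of \<open>g \<theta> * \<psi> \<theta>\<close>.\<close>
  have "continuous_on {0..2*pi} (\<lambda>\<theta>. G \<theta> * \<psi>' \<theta>)"
    unfolding \<psi>'_def using nz abs_continuous_on_imp_continuous_on[OF ac] by (intro continuous_intros) auto
  then have 2: "((\<lambda>\<theta>. G \<theta> * \<psi>' \<theta>) has_integral integral {0..2*pi} (\<lambda>\<theta>. G \<theta> * \<psi>' \<theta>)) {0..2*pi}"
    by (intro integrable_integral integrable_continuous_real)
  have "integral {0..2*pi} (\<lambda>\<theta>. g \<theta> / (cis \<theta> - z)) = - integral {0..2*pi} (\<lambda>\<theta>. G \<theta> * \<psi>' \<theta>)"
    using has_integral_diff[OF 1 2] by (intro integral_unique) (simp add: \<psi>_def)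
  also have "integral {0..2*pi} (\<lambda>\<theta>. G \<theta> * \<psi>' \<theta>) = integral {0..2*pi} (\<lambda>\<theta>. - \<i> * (G \<theta> * (cis \<theta> / (cis \<theta> - z)\<^sup>2)))"
    by (intro integral_cong) (simp add: \<psi>'_def)
  also have "\<dots> = - \<i> * integral {0..2*pi} (\<lambda>\<theta>. G \<theta> * (cis \<theta> / (cis \<theta> - z)\<^sup>2))"
    by (rule integral_mult_right)
  finally show ?thesis by (simp add: algebra_simps flip: mult.assoc)
qed

section \<open>Membership in the Bergman space\<close>

lemma bergman_space_cong:
  assumes "f \<in> bergman_space p" "\<And>z. z \<in> ball 0 1 \<Longrightarrow> f z = g z"
  shows "g \<in> bergman_space p"
proof -
  have "g holomorphic_on ball 0 1"
    using assms holomorphic_transform[of f "ball 0 1" g] by (auto simp: bergman_space_def)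
  moreover have "(\<lambda>z. norm (g z) powr p) integrable_on ball 0 1"
    using assms integrable_cong[of "ball 0 1" "\<lambda>z. norm (f z) powr p" "\<lambda>z. norm (g z) powr p"]
    by (auto simp: bergman_space_def)
  ultimately show ?thesis by (simp add: bergman_space_def)
qed

lemma bergman_space_cmult:
  assumes "f \<in> bergman_space p"
  shows "(\<lambda>z. c * f z) \<in> bergman_space p"
proof -
  have "(\<lambda>z. norm c powr p * norm (f z) powr p) integrable_on ball 0 1"
    using assms by (intro integrable_on_mult_right) (simp add: bergman_space_def)
  then show ?thesis
    using assms by (auto simp: bergman_space_def norm_mult powr_mult intro: holomorphic_intros)
qed

text \<open>By parts, the derivative is \<open>- \<i>\<close> times the Cauchy transform of
  \<open>g\<close>, so the two have the same modulus. Stated for general \<open>G\<close> so as to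
  serve the boundary function and its conjugate alike.\<close>

lemma deriv_szego_integral_in_bergman_space:
  assumes p: "p \<ge> 1" and ac: "abs_continuous_on 0 (2*pi) G" and per: "G 0 = G (2 * pi)"
    and deriv: "AE \<theta> in lborel. \<theta> \<in> {0..2*pi} \<longrightarrow> (G has_vector_derivative g \<theta>) (at \<theta>)"
    and g: "Lp_circle p g"
  shows "deriv (szego_integral G) \<in> bergman_space p"
proof -
  note der = has_field_derivative_szego_integral[OF abs_continuous_on_imp_continuous_on[OF ac]]
  have hol: "deriv (szego_integral G) holomorphic_on ball 0 1"
    using der by (intro holomorphic_deriv) (auto simp only: holomorphic_on_open open_ball)
  have eq: "norm (deriv (szego_integral G) z) = norm (integral {0..2*pi} (\<lambda>\<theta>. g \<theta> / (cis \<theta> - z)))"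
    if "z \<in> ball 0 1" for z
    using DERIV_imp_deriv[OF der[OF that]] integral_by_parts_cauchy_kernel[OF ac per deriv that]
    by (simp add: norm_mult)
  \<comment> \<open>For a nonnegative function, gauge integrability is Lebesgue
    integrability.\<close>
  have "integrable (lebesgue_on {0..2*pi}) (\<lambda>\<theta>. norm (g \<theta>) powr p)"
    using g nonnegative_absolutely_integrable_1[of "\<lambda>\<theta>. norm (g \<theta>) powr p" "{0..2*pi}"]
    by (simp add: Lp_circle_def set_integrable_def integrable_restrict_space)
  then have fin: "(\<integral>\<^sup>+z. ennreal (norm (integral {0..2*pi} (\<lambda>\<theta>. g \<theta> / (cis \<theta> - z))) powr p)
      * indicator (ball 0 1) z \<partial>lborel) < \<infinity>"
    using g p by (intro nn_integral_cauchy_transform_powr_finite) (auto simp: Lp_circle_def)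
  have "set_integrable lborel (ball 0 1) (\<lambda>z. norm (deriv (szego_integral G) z) powr p)"
    unfolding set_integrable_def
  proof (rule integrableI_bounded)
    \<comment> \<open>Measurability in \<open>z\<close> comes from continuity of the holomorphic
      derivative.\<close>
    have "continuous_on (ball 0 1) (\<lambda>z. norm (deriv (szego_integral G) z) powr p)"
      using holomorphic_on_imp_continuous_on[OF hol] p by (intro continuous_on_powr' continuous_intros) auto
    then have "(\<lambda>z. indicator (ball 0 1) z *\<^sub>R norm (deriv (szego_integral G) z) powr p) \<in> borel_measurable borel"
      by (intro borel_measurable_continuous_on_indicator) auto
    then show "(\<lambda>z. indicator (ball 0 1) z *\<^sub>R norm (deriv (szego_integral G) z) powr p) \<in> borel_measurable lborel"
      by simp
    have "(\<integral>\<^sup>+z. ennreal (norm (indicator (ball 0 1) z *\<^sub>R norm (deriv (szego_integral G) z) powr p)) \<partial>lborel)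
        = (\<integral>\<^sup>+z. ennreal (norm (integral {0..2*pi} (\<lambda>\<theta>. g \<theta> / (cis \<theta> - z))) powr p) * indicator (ball 0 1) z \<partial>lborel)"
      by (intro nn_integral_cong) (auto simp: indicator_def eq)
    with fin show "(\<integral>\<^sup>+z. ennreal (norm (indicator (ball 0 1) z *\<^sub>R norm (deriv (szego_integral G) z) powr p)) \<partial>lborel) < \<infinity>"
      by simp
  qed
  then have "(\<lambda>z. norm (deriv (szego_integral G) z) powr p) integrable_on ball 0 1"
    by (rule set_borel_integral_eq_integral)
  with hol show ?thesis by (simp add: bergman_space_def)
qed

section \<open>Wirtinger derivatives and splitting of the Poisson kernel\<close>

text \<open>In direction \<open>v\<close> the derivative is \<open>v * h' + cnj (v * k')\<close>.
  The directions 1 and \<open>\<i>\<close> give \<open>dx\<close> and \<open>dy\<close>, whose two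
  combinations each cancel one of the terms.\<close>

lemma dz_dzbar_holomorphic_plus_cnj:
  assumes S: "open S" "z \<in> S" and f: "\<And>w. w \<in> S \<Longrightarrow> f w = h w + cnj (k w)"
    and h: "(h has_field_derivative h') (at z)" and k: "(k has_field_derivative k') (at z)"
  shows "dz f z = h'" "dzbar f z = cnj k'"
proof -
  have vec: "((\<lambda>t. f (z + v * of_real t)) has_vector_derivative (v * h' + cnj (v * k'))) (at 0)" for v
  proof (rule has_vector_derivative_transform_within_open)
    have v: "((\<lambda>t. z + v * of_real t) has_vector_derivative v) (at 0)"
      by (auto intro!: derivative_eq_intros)
    have "(h \<circ> (\<lambda>t. z + v * of_real t) has_vector_derivative v * h') (at 0)"
      using h by (intro field_vector_diff_chain_at[OF v]) simp
    moreover have "(k \<circ> (\<lambda>t. z + v * of_real t) has_vector_derivative v * k') (at 0)"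
      using k by (intro field_vector_diff_chain_at[OF v]) simp
    ultimately show "((\<lambda>t. h (z + v * of_real t) + cnj (k (z + v * of_real t))) has_vector_derivative
        (v * h' + cnj (v * k'))) (at 0)"
      unfolding o_def by (intro has_vector_derivative_add has_vector_derivative_cnj)
    have "open ((\<lambda>t::real. z + v * of_real t) -` S)"
      by (intro open_vimage S continuous_intros)
    then show "open {t::real. z + v * of_real t \<in> S}"
      by (simp add: vimage_def)
  qed (use S f in auto)
  have "dx f z = h' + cnj k'"
    unfolding dx_def using vec[of 1] by (simp add: vector_derivative_at)
  moreover have "dy f z = \<i> * h' + cnj (\<i> * k')"
    unfolding dy_def using vec[of \<i>] by (simp add: vector_derivative_at)
  ultimately show "dz f z = h'" "dzbar f z = cnj k'"
    by (simp_all add: dz_def dzbar_def ring_distribs flip: mult.assoc)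
qed

text \<open>With \<open>a = z * cis (- \<theta>)\<close>, of the same modulus as \<open>z\<close>,
  the quotient of \<open>1 - a * cnj a\<close> by \<open>(1 - a) * (1 - cnj a)\<close> is resolved
  into partial fractions.\<close>

lemma of_real_poisson_kernel:
  assumes "z \<in> ball 0 1"
  shows "of_real (poisson_kernel z \<theta>) =
    (1 / (1 - z * cis (- \<theta>)) + cnj (1 / (1 - z * cis (- \<theta>))) - 1) / (2 * pi)"
proof -
  define a where "a = z * cis (- \<theta>)"
  have "cmod a = cmod z" by (simp add: a_def norm_mult)
  then have "1 - a \<noteq> 0" using assms by auto
  then have nz: "1 - a \<noteq> 0" "1 - cnj a \<noteq> 0"
    using complex_cnj_cancel_iff[of "1 - a" 0] by simp_all
  have "of_real (poisson_kernel z \<theta>) = (1 - a * cnj a) / ((1 - a) * (1 - cnj a)) / (2 * pi)"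
    unfolding poisson_kernel_def a_def[symmetric] \<open>cmod a = cmod z\<close>[symmetric]
    using complex_norm_square[of a] complex_norm_square[of "1 - a"] by (simp add: mult.commute)
  also have "(1 - a * cnj a) / ((1 - a) * (1 - cnj a)) = 1 / (1 - a) + 1 / (1 - cnj a) - 1"
    using nz by (simp add: divide_simps) (simp add: algebra_simps)
  finally show ?thesis by (simp add: a_def)
qed

text \<open>The conjugated half of the kernel becomes the conjugate of a Szego integral once the
  density is conjugated as well; the constant term joins the holomorphic part.\<close>

lemma poisson_integral_eq_szego:
  assumes G: "continuous_on {0..2*pi} (\<lambda>\<theta>. F (cis \<theta>))" and z: "z \<in> ball 0 1"
  shows "poisson_integral F z =
    (szego_integral (\<lambda>\<theta>. F (cis \<theta>)) z - integral {0..2*pi} (\<lambda>\<theta>. F (cis \<theta>))) / (2 * pi)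
    + cnj (szego_integral (\<lambda>\<theta>. cnj (F (cis \<theta>))) z / (2 * pi))"
proof -
  let ?G = "\<lambda>\<theta>. F (cis \<theta>)"
  have nz: "1 - z * cis (- \<theta>) \<noteq> 0" for \<theta>
    using cis_diff_nonzero[OF z, of \<theta>] by (simp add: one_minus_mult_cis)
  have int: "(\<lambda>\<theta>. ?G \<theta> / (1 - z * cis (- \<theta>))) integrable_on {0..2*pi}"
    "(\<lambda>\<theta>. cnj (?G \<theta>) / (1 - z * cis (- \<theta>))) integrable_on {0..2*pi}" "?G integrable_on {0..2*pi}"
    using G nz by (intro integrable_continuous_real continuous_intros; simp)+
  have int': "(\<lambda>\<theta>. cnj (cnj (?G \<theta>) / (1 - z * cis (- \<theta>)))) integrable_on {0..2*pi}"
    using int(2) by (subst integrable_on_cnj_iff)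
  have "poisson_integral F z = integral {0..2*pi} (\<lambda>\<theta>.
      (?G \<theta> / (1 - z * cis (- \<theta>)) + cnj (cnj (?G \<theta>) / (1 - z * cis (- \<theta>))) - ?G \<theta>) / (2 * pi))"
    unfolding poisson_integral_def
    by (intro integral_cong) (simp add: of_real_poisson_kernel[OF z] add_divide_distrib diff_divide_distrib algebra_simps)
  also have "\<dots> = (integral {0..2*pi} (\<lambda>\<theta>. ?G \<theta> / (1 - z * cis (- \<theta>)))
      + integral {0..2*pi} (\<lambda>\<theta>. cnj (cnj (?G \<theta>) / (1 - z * cis (- \<theta>)))) - integral {0..2*pi} ?G) / (2 * pi)"
    using int int' by (simp only: integral_divide integral_diff integral_add integrable_add)
  also have "integral {0..2*pi} (\<lambda>\<theta>. cnj (cnj (?G \<theta>) / (1 - z * cis (- \<theta>))))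
      = cnj (szego_integral (\<lambda>\<theta>. cnj (?G \<theta>)) z)"
    unfolding szego_integral_def by (rule integral_cnj[symmetric])
  finally show ?thesis
    by (simp add: szego_integral_def add_divide_distrib diff_divide_distrib)
qed

theorem theorem1:
  fixes p :: real and F :: "complex \<Rightarrow> complex" and Fdot :: "real \<Rightarrow> complex"
  assumes "1 \<le> p"
    and "abs_continuous_on 0 (2*pi) (\<lambda>\<theta>. F (cis \<theta>))"
    and "AE \<theta> in lborel. \<theta> \<in> {0..2*pi} \<longrightarrow>
           ((\<lambda>t. F (cis t)) has_vector_derivative Fdot \<theta>) (at \<theta>)"
    and "Lp_circle p Fdot"
  shows "dz (poisson_integral F) \<in> bergman_space p
       \<and> (\<lambda>z. cnj (dzbar (poisson_integral F) z)) \<in> bergman_space p"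
proof -
  define G where "G \<theta> = F (cis \<theta>)" for \<theta>
  \<comment> \<open>Conjugation preserves the norm of every increment.\<close>
  have ac: "abs_continuous_on 0 (2*pi) G" "abs_continuous_on 0 (2*pi) (\<lambda>\<theta>. cnj (G \<theta>))"
    using assms(2) unfolding abs_continuous_on_def G_def
    by (simp_all flip: complex_cnj_diff)
  have cont: "continuous_on {0..2*pi} G" "continuous_on {0..2*pi} (\<lambda>\<theta>. cnj (G \<theta>))"
    using ac by (auto intro: abs_continuous_on_imp_continuous_on)
  have dG: "AE \<theta> in lborel. \<theta> \<in> {0..2*pi} \<longrightarrow> (G has_vector_derivative Fdot \<theta>) (at \<theta>)"
    using assms(3) by (simp add: G_def[abs_def])
  then have dcG: "AE \<theta> in lborel. \<theta> \<in> {0..2*pi} \<longrightarrow>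
      ((\<lambda>\<theta>. cnj (G \<theta>)) has_vector_derivative cnj (Fdot \<theta>)) (at \<theta>)"
    by eventually_elim (auto intro: has_vector_derivative_cnj)
  have per: "G 0 = G (2 * pi)"
    by (simp add: G_def)
  have Lp: "Lp_circle p (\<lambda>\<theta>. cnj (Fdot \<theta>))"
    using assms(4) borel_measurable_continuous_onI[OF continuous_on_cnj[OF continuous_on_id]]
    by (auto simp: Lp_circle_def intro: measurable_compose)
  have B: "deriv (szego_integral G) \<in> bergman_space p"
    "deriv (szego_integral (\<lambda>\<theta>. cnj (G \<theta>))) \<in> bergman_space p"
    using assms ac per dG dcG Lp by (auto intro!: deriv_szego_integral_in_bergman_space)
  have der: "(szego_integral \<phi> has_field_derivative deriv (szego_integral \<phi>) z) (at z)"
    if "continuous_on {0..2*pi} \<phi>" "z \<in> ball 0 1" for \<phi> z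
    using has_field_derivative_szego_integral[OF that] DERIV_imp_deriv by metis
  \<comment> \<open>The factor comes from the normalisation of the Poisson kernel, and the constant
    in the holomorphic part disappears on differentiation.\<close>
  have *: "dz (poisson_integral F) z = 1 / (2 * pi) * deriv (szego_integral G) z"
    "dzbar (poisson_integral F) z = cnj (1 / (2 * pi) * deriv (szego_integral (\<lambda>\<theta>. cnj (G \<theta>))) z)"
    if z: "z \<in> ball 0 1" for z
  proof -
    let ?h = "\<lambda>w. (szego_integral G w - integral {0..2*pi} G) / (2 * pi)"
    let ?k = "\<lambda>w. szego_integral (\<lambda>\<theta>. cnj (G \<theta>)) w / (2 * pi)"
    have eq: "poisson_integral F w = ?h w + cnj (?k w)" if "w \<in> ball 0 1" for w
      using poisson_integral_eq_szego[OF _ that] cont(1) by (simp add: G_def[abs_def])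
    have h: "(?h has_field_derivative 1 / (2 * pi) * deriv (szego_integral G) z) (at z)"
      using der[OF cont(1) z] by (auto intro!: derivative_eq_intros)
    have k: "(?k has_field_derivative 1 / (2 * pi) * deriv (szego_integral (\<lambda>\<theta>. cnj (G \<theta>))) z) (at z)"
      using der[OF cont(2) z] by (auto intro!: derivative_eq_intros)
    show "dz (poisson_integral F) z = 1 / (2 * pi) * deriv (szego_integral G) z"
      "dzbar (poisson_integral F) z = cnj (1 / (2 * pi) * deriv (szego_integral (\<lambda>\<theta>. cnj (G \<theta>))) z)"
      using dz_dzbar_holomorphic_plus_cnj[OF open_ball z eq h k] by auto
  qed
  \<comment> \<open>The formulas hold on the disk only, which suffices because membership in the
    Bergman space depends only on the values there.\<close>
  show ?thesis
  proof
    show "dz (poisson_integral F) \<in> bergman_space p"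
      by (rule bergman_space_cong[OF bergman_space_cmult[OF B(1), of "1 / (2 * pi)"]]) (simp add: *)
    show "(\<lambda>z. cnj (dzbar (poisson_integral F) z)) \<in> bergman_space p"
      by (rule bergman_space_cong[OF bergman_space_cmult[OF B(2), of "1 / (2 * pi)"]]) (simp add: *)
  qed
qed

end
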